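(* Let $\big(p(t,x),q(t,x),\{b_k(t,x)\}_{k\ge 0}\big)$ be solution data (holomorphic functions near $(0,0)\in\mathbb{C}^2$, as in the context) satisfying the initial conditions $$p(0,x)\equiv 0,\quad q(0,x)\equiv x,\quad q_t(0,0)=1,\quad b_0(0,x)\equiv 1,\quad b_1(0,x)\equiv 1,\quad b_k(0,x)\equiv 0\ (k\ge 2),$$ and suppose that it is a fixed point of the mapping $\boldsymbol{F}$ defined in the context: $$\boldsymbol{F}\big(p,q,\{b_k\}_{k\ge0}\big)=\big(p,q,\{b_k\}_{k\ge0}\big).$$ Then the function $$u(t,x)=\partial_q^{-1}\Big(\sum_{k=0}^{\infty}b_k(t,x)\,z^k\Big):=\sum_{k=1}^{\infty}\frac1k\big(-p\,b_{k-1}+3\,b_{k-3}\big)z^k,\qquad z^3=p\,z+q,$$ satisfies the equation $$u_{tt}-u_x\,u_{xx}=0$$ together with the initial condition $u(0,x)=\sum_{j=1}^{N_0}c_j\,x^{1+\frac{j-1}{3}}$, where the coefficients corresponding to the initial conditions above are $c_1=1$, $c_2=\tfrac34$ and $c_j=0$ for $j\ge3$, i.e. $u(0,x)=x+\tfrac34\,x^{4/3}$.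
   Context: Conventions: $b_{-j}\equiv 0$ for all $j\ge1$; any term with a factor $1/0$ is multiplied by such a vanishing $b$ and is read as $0$. Indices after a comma denote partial derivatives, e.g. $b_{k,x}=\partial_x b_k$. Solution data are functions $p,q,b_k$ holomorphic on a common neighbourhood of $(0,0)$ such that $\sum_k \sup|b_k|\,\varepsilon^k<\infty$ for some $\varepsilon>0$ (sup over that neighbourhood), so all series below converge near the origin. The function $z(t,x)$ is a branch of the solution of $z^3=pz+q$ (defined near points close to the origin with $4p^3-27q^2\ne0$), and $z(0,x)=x^{1/3}$ for the chosen branch. The mapping $\boldsymbol{F}$ sends $(p,q,\{b_k\})$ to $(\hat p,\hat q,\{\hat b_k\})$ defined as follows. For $j\in\mathbb{N}=\{0,1,2,\dots\}$ put $$U_j=\Big(1-\tfrac1j\Big)p_x b_{j-1}+q_x b_j+\tfrac1j\big(-p\,b_{j-1,x}+3\,b_{j-3,x}\big),$$ $$W_j=(j-1)p_x^2\,b_{j-1}+2j\,p_xq_x\,b_j+(j+1)q_x^2\,b_{j+1}.$$ Let $\mathcal{B}_k=\sum_{j=0}^k U_jW_{k-j}-(k-1)p_t^2\,b_{k-1}$ for $k\ge 0$. Then $\hat p,\hat q$ solve $$\begin{pmatrix}\hat p_t\\ \hat q_t\end{pmatrix}=\mathbb{M}^{-1}\begin{pmatrix}\sum_{k\ge0}(p/3)^k\mathcal{B}_{2k}\\ \sum_{k\ge0}(p/3)^k\mathcal{B}_{2k+1}\end{pmatrix},\qquad \hat p(0,x)=0,\quad \hat q(0,x)=x,$$ where $$\mathbb{M}=\begin{pmatrix}4\sum_{k\ge0}(p/3)^k\,k\,q_t\,b_{2k}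 & \sum_{k\ge0}(p/3)^k(2k+1)q_t\,b_{2k+1}\\ 2\sum_{k\ge0}(p/3)^k(2k+1)q_t\,b_{2k+1} & 2\sum_{k\ge0}(p/3)^k(k+1)q_t\,b_{2k+2}\end{pmatrix}$$ (invertible near the origin). Next, for $k\ge0$, let $$\mathcal{A}_k=(k-1)b_{k-1}p_t^2+2k\,b_k\,\hat p_t q_t+(k+1)\hat q_t q_t\,b_{k+1}-\sum_{j=0}^kU_jW_{k-j},\qquad \mathcal{C}_k=\sum_{j\ge0}\mathcal{A}_{k+2+2j}\Big(\frac p3\Big)^j .$$ Finally, $\hat b_k$ ($k\ge0$) is defined by the initial conditions $\hat b_0(0,x)=\hat b_1(0,x)=1$, $\hat b_k(0,x)=0$ for $k\ge2$, and $$\partial_t\hat b_k=\frac1{2q_t}\Big\{-\Big(2-\tfrac2k\Big)b_{k-1,t}p_t-\Big(1-\tfrac1k\Big)b_{k-1}p_{tt}-b_kq_{tt}-\tfrac1k\big(-p\,b_{k-1,tt}+3b_{k-3,tt}\big)-\mathcal{C}_k+\sum_{j=0}^kU_jX_{k-j}\Big\},$$ where $$X_j=\Big(2-\tfrac2j\Big)b_{j-1,x}p_x+\Big(1-\tfrac1j\Big)b_{j-1}p_{tt}+b_jq_{xx}+2b_{j,x}q_x+\tfrac1j\big(-p\,b_{j-1,xx}+3b_{j-3,xx}\big).$$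
   Formalization: Two formulas of F are corrected: in X_j the term (1-1/j)b_{j-1}p_tt is read with p_xx, and in the equation for b-hat_k the term -C_k is read as -(1/3)C_k; as printed, every fixed point has z^0 coefficient -1/6 in u_tt-u_x u_xx at t=0. *)

theory Defs
  imports "HOL-Complex_Analysis.Complex_Analysis"
begin

text \<open>
  Functions of \<open>(t, x)\<close> are curried, and \<open>b k\<close> is the coefficient function \<open>b\<^sub>k\<close>.
\<close>

definition Dt :: "(complex \<Rightarrow> complex \<Rightarrow> complex) \<Rightarrow> complex \<Rightarrow> complex \<Rightarrow> complex" where
  "Dt f t x = deriv (\<lambda>s. f s x) t"

definition Dx :: "(complex \<Rightarrow> complex \<Rightarrow> complex) \<Rightarrow> complex \<Rightarrow> complex \<Rightarrow> complex" where
  "Dx f t x = deriv (\<lambda>y. f t y) x"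

text \<open>Holomorphy in two variables, for open sets \<open>S\<close>: the Frechet derivative exists and is
  complex-linear at every point.\<close>

definition holomorphic2_on :: "(complex \<Rightarrow> complex \<Rightarrow> complex) \<Rightarrow> (complex \<times> complex) set \<Rightarrow> bool"
    (infixl "holomorphic2'_on" 50) where
  "f holomorphic2_on S \<longleftrightarrow>
     (\<forall>w\<in>S. \<exists>\<alpha> \<beta>. ((\<lambda>v. f (fst v) (snd v)) has_derivative (\<lambda>h. \<alpha> * fst h + \<beta> * snd h)) (at w))"

definition solution_data ::
  "(complex \<Rightarrow> complex \<Rightarrow> complex) \<Rightarrow> (complex \<Rightarrow> complex \<Rightarrow> complex)
    \<Rightarrow> (nat \<Rightarrow> complex \<Rightarrow> complex \<Rightarrow> complex) \<Rightarrow> bool" where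
  "solution_data p q b \<longleftrightarrow>
     (\<exists>N. open N \<and> (0, 0) \<in> N \<and>
          p holomorphic2_on N \<and> q holomorphic2_on N \<and> (\<forall>k. b k holomorphic2_on N) \<and>
          (\<forall>k. bounded ((\<lambda>w. b k (fst w) (snd w)) ` N)) \<and>
          (\<exists>\<epsilon>>0. summable (\<lambda>k. (SUP w\<in>N. norm (b k (fst w) (snd w))) * \<epsilon> ^ k)))"

text \<open>\<open>shift b i j\<close> is \<open>b\<^bsub>j - i\<^esub>\<close> with the convention \<open>b\<^bsub>-m\<^esub> = 0\<close> for \<open>m \<ge> 1\<close> (subtraction on
  \<^typ>\<open>nat\<close> would truncate instead). Since \<open>1 / 0 = 0\<close> in HOL, the terms with \<open>1/j\<close> at \<open>j = 0\<close>
  vanish; in \<open>1 - 1/j\<close> and \<open>2 - 2/j\<close> at \<open>j = 0\<close> the factor \<open>b\<^bsub>-1\<^esub> = 0\<close> does this.\<close>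

definition shift :: "(nat \<Rightarrow> complex \<Rightarrow> complex \<Rightarrow> complex) \<Rightarrow> nat \<Rightarrow> nat \<Rightarrow> complex \<Rightarrow> complex \<Rightarrow> complex" where
  "shift b i j = (if j < i then (\<lambda>t x. 0) else b (j - i))"

definition coefU ::
  "(complex \<Rightarrow> complex \<Rightarrow> complex) \<Rightarrow> (complex \<Rightarrow> complex \<Rightarrow> complex)
    \<Rightarrow> (nat \<Rightarrow> complex \<Rightarrow> complex \<Rightarrow> complex) \<Rightarrow> nat \<Rightarrow> complex \<Rightarrow> complex \<Rightarrow> complex" where
  "coefU p q b j t x =
     (1 - 1 / of_nat j) * Dx p t x * shift b 1 j t x + Dx q t x * b j t x
     + 1 / of_nat j * (- p t x * Dx (shift b 1 j) t x + 3 * Dx (shift b 3 j) t x)"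

definition coefW ::
  "(complex \<Rightarrow> complex \<Rightarrow> complex) \<Rightarrow> (complex \<Rightarrow> complex \<Rightarrow> complex)
    \<Rightarrow> (nat \<Rightarrow> complex \<Rightarrow> complex \<Rightarrow> complex) \<Rightarrow> nat \<Rightarrow> complex \<Rightarrow> complex \<Rightarrow> complex" where
  "coefW p q b j t x =
     (of_nat j - 1) * (Dx p t x)\<^sup>2 * shift b 1 j t x
     + 2 * of_nat j * Dx p t x * Dx q t x * b j t x
     + (of_nat j + 1) * (Dx q t x)\<^sup>2 * b (j + 1) t x"

text \<open>With \<open>u = (\<Sum>k. 1/k * (- p * b\<^bsub>k-1\<^esub> + 3 * b\<^bsub>k-3\<^esub>) * z^k)\<close> and \<open>z\<^sub>q = 1 / (3 * z\<^sup>2 - p)\<close>, the chain rule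
  gives \<open>u\<^sub>x = (\<Sum>j. U\<^sub>j * z^j)\<close> and \<open>u\<^sub>x\<^sub>x = z\<^sub>q * (\<Sum>j. W\<^sub>j * z^j) + (\<Sum>j. X\<^sub>j * z^j)\<close>. The second term of \<open>X\<^sub>j\<close>
  therefore carries \<open>p\<^sub>x\<^sub>x\<close>; a printed \<open>p\<^sub>t\<^sub>t\<close> in this place is a misprint.\<close>

definition coefX ::
  "(complex \<Rightarrow> complex \<Rightarrow> complex) \<Rightarrow> (complex \<Rightarrow> complex \<Rightarrow> complex)
    \<Rightarrow> (nat \<Rightarrow> complex \<Rightarrow> complex \<Rightarrow> complex) \<Rightarrow> nat \<Rightarrow> complex \<Rightarrow> complex \<Rightarrow> complex" where
  "coefX p q b j t x =
     (2 - 2 / of_nat j) * Dx (shift b 1 j) t x * Dx p t x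
     + (1 - 1 / of_nat j) * shift b 1 j t x * Dx (Dx p) t x
     + b j t x * Dx (Dx q) t x + 2 * Dx (b j) t x * Dx q t x
     + 1 / of_nat j * (- p t x * Dx (Dx (shift b 1 j)) t x + 3 * Dx (Dx (shift b 3 j)) t x)"

definition calB ::
  "(complex \<Rightarrow> complex \<Rightarrow> complex) \<Rightarrow> (complex \<Rightarrow> complex \<Rightarrow> complex)
    \<Rightarrow> (nat \<Rightarrow> complex \<Rightarrow> complex \<Rightarrow> complex) \<Rightarrow> nat \<Rightarrow> complex \<Rightarrow> complex \<Rightarrow> complex" where
  "calB p q b k t x =
     (\<Sum>j\<le>k. coefU p q b j t x * coefW p q b (k - j) t x)
     - (of_nat k - 1) * (Dt p t x)\<^sup>2 * shift b 1 k t x"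

definition matM ::
  "(complex \<Rightarrow> complex \<Rightarrow> complex) \<Rightarrow> (complex \<Rightarrow> complex \<Rightarrow> complex)
    \<Rightarrow> (nat \<Rightarrow> complex \<Rightarrow> complex \<Rightarrow> complex) \<Rightarrow> complex \<Rightarrow> complex \<Rightarrow> complex ^ 2 ^ 2" where
  "matM p q b t x = vector
     [vector [4 * (\<Sum>k. (p t x / 3) ^ k * of_nat k * Dt q t x * b (2 * k) t x),
              (\<Sum>k. (p t x / 3) ^ k * of_nat (2 * k + 1) * Dt q t x * b (2 * k + 1) t x)],
      vector [2 * (\<Sum>k. (p t x / 3) ^ k * of_nat (2 * k + 1) * Dt q t x * b (2 * k + 1) t x),
              2 * (\<Sum>k. (p t x / 3) ^ k * of_nat (k + 1) * Dt q t x * b (2 * k + 2) t x)]]"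

definition rhsB ::
  "(complex \<Rightarrow> complex \<Rightarrow> complex) \<Rightarrow> (complex \<Rightarrow> complex \<Rightarrow> complex)
    \<Rightarrow> (nat \<Rightarrow> complex \<Rightarrow> complex \<Rightarrow> complex) \<Rightarrow> complex \<Rightarrow> complex \<Rightarrow> complex ^ 2" where
  "rhsB p q b t x = vector
     [(\<Sum>k. (p t x / 3) ^ k * calB p q b (2 * k) t x),
      (\<Sum>k. (p t x / 3) ^ k * calB p q b (2 * k + 1) t x)]"

text \<open>In \<open>calA\<close> and \<open>calC\<close> the arguments \<open>ph\<close>, \<open>qh\<close> are the new functions \<open>p\<close>-hat, \<open>q\<close>-hat.\<close>

definition calA ::
  "(complex \<Rightarrow> complex \<Rightarrow> complex) \<Rightarrow> (complex \<Rightarrow> complex \<Rightarrow> complex)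
    \<Rightarrow> (nat \<Rightarrow> complex \<Rightarrow> complex \<Rightarrow> complex)
    \<Rightarrow> (complex \<Rightarrow> complex \<Rightarrow> complex) \<Rightarrow> (complex \<Rightarrow> complex \<Rightarrow> complex)
    \<Rightarrow> nat \<Rightarrow> complex \<Rightarrow> complex \<Rightarrow> complex" where
  "calA p q b ph qh k t x =
     (of_nat k - 1) * shift b 1 k t x * (Dt p t x)\<^sup>2
     + 2 * of_nat k * b k t x * Dt ph t x * Dt q t x
     + (of_nat k + 1) * Dt qh t x * Dt q t x * b (k + 1) t x
     - (\<Sum>j\<le>k. coefU p q b j t x * coefW p q b (k - j) t x)"

definition calC ::
  "(complex \<Rightarrow> complex \<Rightarrow> complex) \<Rightarrow> (complex \<Rightarrow> complex \<Rightarrow> complex)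
    \<Rightarrow> (nat \<Rightarrow> complex \<Rightarrow> complex \<Rightarrow> complex)
    \<Rightarrow> (complex \<Rightarrow> complex \<Rightarrow> complex) \<Rightarrow> (complex \<Rightarrow> complex \<Rightarrow> complex)
    \<Rightarrow> nat \<Rightarrow> complex \<Rightarrow> complex \<Rightarrow> complex" where
  "calC p q b ph qh k t x =
     (\<Sum>j. calA p q b ph qh (k + 2 + 2 * j) t x * (p t x / 3) ^ j)"

text \<open>The right-hand side of the equation for \<open>\<partial>\<^sub>t b\<^sub>k\<close>-hat. When the two sums over the even and the odd
  \<open>A\<^sub>k\<close> vanish at \<open>p/3\<close>, \<open>(\<Sum>k. A\<^sub>k * z^k) = (z\<^sup>2 - p/3) * (\<Sum>k. C\<^sub>k * z^k)\<close>, so that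
  \<open>z\<^sub>q * (\<Sum>k. A\<^sub>k * z^k) = (\<Sum>k. C\<^sub>k/3 * z^k)\<close> because \<open>3 * z\<^sup>2 - p = 3 * (z\<^sup>2 - p/3)\<close>. Hence \<open>C\<^sub>k\<close> enters
  with the factor \<open>1/3\<close>; a printed formula without this factor is a misprint.\<close>

definition rhsb ::
  "(complex \<Rightarrow> complex \<Rightarrow> complex) \<Rightarrow> (complex \<Rightarrow> complex \<Rightarrow> complex)
    \<Rightarrow> (nat \<Rightarrow> complex \<Rightarrow> complex \<Rightarrow> complex)
    \<Rightarrow> (complex \<Rightarrow> complex \<Rightarrow> complex) \<Rightarrow> (complex \<Rightarrow> complex \<Rightarrow> complex)
    \<Rightarrow> nat \<Rightarrow> complex \<Rightarrow> complex \<Rightarrow> complex" where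
  "rhsb p q b ph qh k t x =
     1 / (2 * Dt q t x) *
      (- (2 - 2 / of_nat k) * Dt (shift b 1 k) t x * Dt p t x
       - (1 - 1 / of_nat k) * shift b 1 k t x * Dt (Dt p) t x
       - b k t x * Dt (Dt q) t x
       - 1 / of_nat k * (- p t x * Dt (Dt (shift b 1 k)) t x + 3 * Dt (Dt (shift b 3 k)) t x)
       - 1 / 3 * calC p q b ph qh k t x
       + (\<Sum>j\<le>k. coefU p q b j t x * coefX p q b (k - j) t x))"

text \<open>The mapping \<open>F\<close> acts on germs at the origin and is given by its graph:
  \<open>F_maps p q b ph qh bh\<close> means that \<open>F\<close> sends \<open>(p, q, b)\<close> to \<open>(ph, qh, bh)\<close>. The initial value
  problems determine the germs of \<open>ph\<close>, \<open>qh\<close>, \<open>bh k\<close>.\<close>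

definition F_maps ::
  "(complex \<Rightarrow> complex \<Rightarrow> complex) \<Rightarrow> (complex \<Rightarrow> complex \<Rightarrow> complex)
    \<Rightarrow> (nat \<Rightarrow> complex \<Rightarrow> complex \<Rightarrow> complex)
    \<Rightarrow> (complex \<Rightarrow> complex \<Rightarrow> complex) \<Rightarrow> (complex \<Rightarrow> complex \<Rightarrow> complex)
    \<Rightarrow> (nat \<Rightarrow> complex \<Rightarrow> complex \<Rightarrow> complex) \<Rightarrow> bool" where
  "F_maps p q b ph qh bh \<longleftrightarrow>
     (\<exists>N. open N \<and> (0, 0) \<in> N \<and>
        ph holomorphic2_on N \<and> qh holomorphic2_on N \<and> (\<forall>k. bh k holomorphic2_on N) \<and>
        (\<forall>(t, x)\<in>N. vector [Dt ph t x, Dt qh t x] = matrix_inv (matM p q b t x) *v rhsB p q b t x) \<and>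
        (\<forall>(t, x)\<in>N. \<forall>k. Dt (bh k) t x = rhsb p q b ph qh k t x) \<and>
        (\<forall>x. (0, x) \<in> N \<longrightarrow>
           ph 0 x = 0 \<and> qh 0 x = x \<and> bh 0 0 x = 1 \<and> bh 1 0 x = 1 \<and> (\<forall>k\<ge>2. bh k 0 x = 0)))"

text \<open>The terms of the series for \<open>u = \<partial>\<^sub>q\<^sup>-\<^sup>1 (\<Sum>k. b\<^sub>k * z^k)\<close>; the term with \<open>k = 0\<close> is \<open>0\<close>, so the
  sum over all \<open>k\<close> is the sum over \<open>k \<ge> 1\<close>.\<close>

definition u_term ::
  "(complex \<Rightarrow> complex \<Rightarrow> complex) \<Rightarrow> (nat \<Rightarrow> complex \<Rightarrow> complex \<Rightarrow> complex)
    \<Rightarrow> (complex \<Rightarrow> complex \<Rightarrow> complex) \<Rightarrow> complex \<Rightarrow> complex \<Rightarrow> nat \<Rightarrow> complex" where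
  "u_term p b z t x k =
     1 / of_nat k * (- p t x * shift b 1 k t x + 3 * shift b 3 k t x) * z t x ^ k"

definition u_fun ::
  "(complex \<Rightarrow> complex \<Rightarrow> complex) \<Rightarrow> (nat \<Rightarrow> complex \<Rightarrow> complex \<Rightarrow> complex)
    \<Rightarrow> (complex \<Rightarrow> complex \<Rightarrow> complex) \<Rightarrow> complex \<Rightarrow> complex \<Rightarrow> complex" where
  "u_fun p b z t x = (\<Sum>k. u_term p b z t x k)"

text \<open>\<open>z\<close> is a branch on \<open>D\<close> of the solution of \<open>z^3 = p * z + q\<close>, where \<open>D\<close> avoids the discriminant set.\<close>

definition cubic_branch ::
  "(complex \<Rightarrow> complex \<Rightarrow> complex) \<Rightarrow> (complex \<Rightarrow> complex \<Rightarrow> complex)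
    \<Rightarrow> (complex \<Rightarrow> complex \<Rightarrow> complex) \<Rightarrow> (complex \<times> complex) set \<Rightarrow> bool" where
  "cubic_branch p q z D \<longleftrightarrow>
     open D \<and> (\<forall>(t, x)\<in>D. 4 * p t x ^ 3 - 27 * q t x ^ 2 \<noteq> 0) \<and>
     z holomorphic2_on D \<and> (\<forall>(t, x)\<in>D. z t x ^ 3 = p t x * z t x + q t x)"

text \<open>\<open>r\<close> is a branch of \<open>x^(1/3)\<close> on \<open>S\<close>; the other powers \<open>x^(n/3)\<close> are then \<open>r x ^ n\<close>.\<close>

definition cbrt_branch :: "(complex \<Rightarrow> complex) \<Rightarrow> complex set \<Rightarrow> bool" where
  "cbrt_branch r S \<longleftrightarrow> r holomorphic_on S \<and> (\<forall>x\<in>S. r x ^ 3 = x)"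

end

theory Submission
  imports Defs
begin

text \<open>
  Write \<open>B = (\<Sum>k. b\<^sub>k * \<zeta>^k)\<close> and let \<open>G\<close> be the power series with \<open>G' = (3 * \<zeta>\<^sup>2 - p) * B\<close> and no constant
  term, so that \<open>u = G(z)\<close>. On a root of the cubic \<open>(3 * z\<^sup>2 - p) * z\<^sub>x = p\<^sub>x * z + q\<^sub>x\<close>, hence the factor
  \<open>3 * z\<^sup>2 - p\<close> cancels in \<open>u\<^sub>x = U(z)\<close> and only the second derivatives have the denominator:
  \<open>u\<^sub>x\<^sub>x = X(z) + W(z) / (3 * z\<^sup>2 - p)\<close>, and \<open>u\<^sub>t\<^sub>t = Y(z) + V(z) / (3 * z\<^sup>2 - p)\<close> in the same way.
  The equations for \<open>p\<^sub>t\<close>, \<open>q\<^sub>t\<close> say that \<open>A = V - U * W\<close> vanishes at \<open>\<plusminus>sqrt (p/3)\<close>, so that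
  \<open>A = (\<zeta>\<^sup>2 - p/3) * C\<close>; the equations for the \<open>b\<^sub>k\<close> say \<open>Y - U * X = - C/3\<close>. Together they give
  \<open>u\<^sub>t\<^sub>t - u\<^sub>x * u\<^sub>x\<^sub>x = - C(z)/3 + (z\<^sup>2 - p/3) * C(z) / (3 * z\<^sup>2 - p) = 0\<close>. Near the origin the matrix
  \<open>M\<close> is invertible because its determinant tends to \<open>-2\<close>, and Cauchy estimates on slices of a
  polydisc justify differentiating the series termwise.
\<close>

section \<open>Power series with a common radius of convergence\<close>

text \<open>A fixed lower bound \<open>e\<close> survives sums, products, derivatives and integrals,
  although the radius itself may change under them. Evaluation at any \<open>norm z < e\<close> is
  then additive and multiplicative on all the series involved.\<close>

definition conv :: "real \<Rightarrow> complex fps \<Rightarrow> bool" where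
  "conv e F \<longleftrightarrow> ereal e \<le> fps_conv_radius F"

lemma conv_const [intro]: "conv e (fps_const c)"
  and conv_numeral [intro]: "conv e (numeral n)"
  and conv_fps_X [intro]: "conv e fps_X"
  by (auto simp: conv_def)

lemma conv_add [intro]: "conv e F \<Longrightarrow> conv e G \<Longrightarrow> conv e (F + G)"
  unfolding conv_def by (rule order_trans[OF _ fps_conv_radius_add]) simp

lemma conv_diff [intro]: "conv e F \<Longrightarrow> conv e G \<Longrightarrow> conv e (F - G)"
  unfolding conv_def by (rule order_trans[OF _ fps_conv_radius_diff]) simp

lemma conv_mult [intro]: "conv e F \<Longrightarrow> conv e G \<Longrightarrow> conv e (F * G)"
  unfolding conv_def by (rule order_trans[OF _ fps_conv_radius_mult]) simp

lemma conv_power [intro]: "conv e F \<Longrightarrow> conv e (F ^ n)"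
  unfolding conv_def by (rule order_trans[OF _ fps_conv_radius_power])

lemma conv_deriv [intro]: "conv e F \<Longrightarrow> conv e (fps_deriv F)"
  unfolding conv_def by (rule order_trans[OF _ fps_conv_radius_deriv])

lemma conv_shift: "conv e F \<Longrightarrow> conv e (fps_shift n F)"
  unfolding conv_def by simp

text \<open>Removing the vanishing constant term keeps the radius. What remains has the coefficients
  of \<open>F\<close> divided by \<open>n + 1\<close>, so \<open>F\<close> dominates it
  termwise.\<close>

lemma conv_integral [intro]:
  assumes "conv e F" shows "conv e (fps_integral0 F)"
proof -
  have "fps_conv_radius F \<le> fps_conv_radius (fps_shift 1 (fps_integral0 F))"
    unfolding fps_conv_radius_def[of "fps_shift 1 (fps_integral0 F)"]
  proof (rule conv_radius_geI_ex')
    fix r :: real assume r: "0 < r" "ereal r < fps_conv_radius F"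
    have "summable (\<lambda>n. norm (fps_nth F n * of_real r ^ n))"
      using r by (intro abs_summable_in_conv_radius) (simp add: fps_conv_radius_def)
    moreover have "norm (fps_nth (fps_shift 1 (fps_integral0 F)) n * of_real r ^ n)
        \<le> norm (fps_nth F n * of_real r ^ n)" for n
    proof -
      have "norm (inverse (of_nat (Suc n) :: complex)) \<le> 1"
        unfolding norm_inverse norm_of_nat by (simp add: inverse_le_1_iff)
      then have "norm (inverse (of_nat (Suc n) :: complex)) * norm (fps_nth F n * of_real r ^ n)
          \<le> 1 * norm (fps_nth F n * of_real r ^ n)"
        by (intro mult_right_mono) auto
      then show ?thesis by (simp add: norm_mult mult.assoc del: of_nat_Suc)
    qed
    ultimately show "summable (\<lambda>n. fps_nth (fps_shift 1 (fps_integral0 F)) n * of_real r ^ n)"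
      by (rule summable_comparison_test'[where N = 0])
  qed
  then show ?thesis using assms unfolding conv_def by (simp del: fps_integral_nth_0_Suc)
qed

lemmas conv_intros = conv_const conv_numeral conv_fps_X conv_add conv_diff conv_mult conv_power
  conv_deriv conv_integral

lemma conv_less: "conv e F \<Longrightarrow> norm z < e \<Longrightarrow> ereal (norm z) < fps_conv_radius F"
  unfolding conv_def by (meson ereal_less_eq less_ereal.simps(1) order_less_le_trans)

lemma eval_add: "conv e F \<Longrightarrow> conv e G \<Longrightarrow> norm z < e \<Longrightarrow> eval_fps (F + G) z = eval_fps F z + eval_fps G z"
  and eval_diff: "conv e F \<Longrightarrow> conv e G \<Longrightarrow> norm z < e \<Longrightarrow> eval_fps (F - G) z = eval_fps F z - eval_fps G z"
  and eval_mult: "conv e F \<Longrightarrow> conv e G \<Longrightarrow> norm z < e \<Longrightarrow> eval_fps (F * G) z = eval_fps F z * eval_fps G z"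
  by (auto intro: conv_less eval_fps_add eval_fps_diff eval_fps_mult)

section \<open>Families of coefficients with a common summable majorant\<close>

definition majorized :: "real \<Rightarrow> 'a set \<Rightarrow> (nat \<Rightarrow> 'a \<Rightarrow> complex) \<Rightarrow> bool" where
  "majorized e S a \<longleftrightarrow> (\<exists>m. summable (\<lambda>k. m k * e ^ k) \<and> (\<forall>k. \<forall>s\<in>S. norm (a k s) \<le> m k))"

lemma majorizedI:
  "summable (\<lambda>k. m k * e ^ k) \<Longrightarrow> (\<And>k s. s \<in> S \<Longrightarrow> norm (a k s) \<le> m k) \<Longrightarrow> majorized e S a"
  unfolding majorized_def by blast

lemma majorized_add:
  assumes "majorized e S a" "majorized e S c"
  shows "majorized e S (\<lambda>k s. a k s + c k s)"
proof -
  from assms obtain m n where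
    m: "summable (\<lambda>k. m k * e ^ k)" "\<And>k s. s \<in> S \<Longrightarrow> norm (a k s) \<le> m k" and
    n: "summable (\<lambda>k. n k * e ^ k)" "\<And>k s. s \<in> S \<Longrightarrow> norm (c k s) \<le> n k"
    unfolding majorized_def by blast
  have "summable (\<lambda>k. (m k + n k) * e ^ k)"
    using summable_add[OF m(1) n(1)] by (simp add: algebra_simps)
  then show ?thesis
    by (rule majorizedI) (use m(2) n(2) in \<open>blast intro: norm_triangle_le add_mono\<close>)
qed

lemma majorized_mult:
  assumes "majorized e S a" and g: "\<And>k s. s \<in> S \<Longrightarrow> norm (g k s) \<le> C"
  shows "majorized e S (\<lambda>k s. g k s * a k s)"
proof -
  from assms(1) obtain m where
    m: "summable (\<lambda>k. m k * e ^ k)" "\<And>k s. s \<in> S \<Longrightarrow> norm (a k s) \<le> m k"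
    unfolding majorized_def by blast
  have "summable (\<lambda>k. (C * m k) * e ^ k)"
    using summable_mult[OF m(1), of C] by (simp add: algebra_simps)
  then show ?thesis
  proof (rule majorizedI)
    fix k s assume s: "s \<in> S"
    have "0 \<le> C" using g[OF s] norm_ge_zero order_trans by blast
    then show "norm (g k s * a k s) \<le> C * m k"
      unfolding norm_mult using g[OF s, of k] m(2)[OF s, of k] by (intro mult_mono) auto
  qed
qed

lemma majorized_shift:
  assumes "majorized e S a"
  shows "majorized e S (\<lambda>k s. if k < i then 0 else a (k - i) s)"
proof -
  from assms(1) obtain m where
    m: "summable (\<lambda>k. m k * e ^ k)" "\<And>k s. s \<in> S \<Longrightarrow> norm (a k s) \<le> m k"
    unfolding majorized_def by blast
  have "summable (\<lambda>k. e ^ i * (m k * e ^ k))"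
    by (intro summable_mult m(1))
  then have "summable (\<lambda>k. (if k + i < i then 0 else m (k + i - i)) * e ^ (k + i))"
    by (simp add: power_add mult_ac)
  then have "summable (\<lambda>k. (if k < i then 0 else m (k - i)) * e ^ k)"
    by (subst (asm) summable_iff_shift)
  then show ?thesis
    by (rule majorizedI) (use m(2) in auto)
qed

lemma majorized_subset: "majorized e S a \<Longrightarrow> T \<subseteq> S \<Longrightarrow> majorized e T a"
  unfolding majorized_def by blast

lemma majorized_summable_norm:
  assumes "majorized e S a" "s \<in> S" "norm z \<le> e"
  shows "summable (\<lambda>k. norm (a k s * z ^ k))"
proof -
  from assms(1) obtain m where
    m: "summable (\<lambda>k. m k * e ^ k)" "\<And>k s. s \<in> S \<Longrightarrow> norm (a k s) \<le> m k"
    unfolding majorized_def by blast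
  have "norm (a k s * z ^ k) \<le> m k * e ^ k" for k
    unfolding norm_mult norm_power
    using m(2)[OF assms(2), of k] assms(3) order_trans[OF norm_ge_zero m(2)[OF assms(2), of k]]
    by (intro mult_mono power_mono) auto
  then show ?thesis by (intro summable_comparison_test'[OF m(1)]) auto
qed

lemma majorized_conv:
  assumes "majorized e S a" "s \<in> S" "0 < e"
  shows "conv e (Abs_fps (\<lambda>k. a k s))"
proof -
  have "summable (\<lambda>k. norm (a k s * of_real e ^ k))"
    by (rule majorized_summable_norm) (use assms in auto)
  then have "summable (\<lambda>k. a k s * of_real e ^ k)" by (rule summable_norm_cancel)
  from conv_radius_geI[OF this] show ?thesis
    using assms(3) by (simp add: conv_def fps_conv_radius_def)
qed

text \<open>By the majorant the series of holomorphic functions converges uniformly on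
  \<open>S\<close>, so it can be differentiated termwise. The result splits into the change of the
  coefficients and the chain rule through \<open>w\<close>.\<close>

lemma has_field_derivative_fps_family:
  fixes a :: "nat \<Rightarrow> complex \<Rightarrow> complex" and w :: "complex \<Rightarrow> complex"
  assumes S: "open S" and a: "\<And>k. a k holomorphic_on S" and w: "w holomorphic_on S"
    and e: "0 < e" and maj: "majorized e S a" and small: "\<And>s. s \<in> S \<Longrightarrow> norm (w s) < e"
    and s: "s \<in> S"
  shows "((\<lambda>s. eval_fps (Abs_fps (\<lambda>k. a k s)) (w s)) has_field_derivative
     eval_fps (Abs_fps (\<lambda>k. deriv (a k) s)) (w s)
     + eval_fps (fps_deriv (Abs_fps (\<lambda>k. a k s))) (w s) * deriv w s) (at s)"
proof -
  obtain m where
    m: "summable (\<lambda>k. m k * e ^ k)" "\<And>k s. s \<in> S \<Longrightarrow> norm (a k s) \<le> m k"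
    using maj unfolding majorized_def by blast
  have m0: "0 \<le> m k" for k using m(2)[OF s, of k] norm_ge_zero order_trans by blast
  let ?f' = "\<lambda>k s. deriv (a k) s * w s ^ k + a k s * (of_nat k * w s ^ (k - 1) * deriv w s)"
  have der: "((\<lambda>s. a k s * w s ^ k) has_field_derivative ?f' k s) (at s)" if "s \<in> S" for k s
    by (rule derivative_eq_intros holomorphic_derivI[OF a S that] holomorphic_derivI[OF w S that]
        refl | simp)+
  have "\<exists>g g'. \<forall>s\<in>S. ((\<lambda>k. a k s * w s ^ k) sums g s) \<and> ((\<lambda>k. ?f' k s) sums g' s)
      \<and> (g has_field_derivative g' s) (at s)"
  proof (rule series_and_derivative_comparison_complex[OF S der])
    fix s assume "s \<in> S"
    have "norm (a k y * w y ^ k) \<le> norm (of_real (m k * e ^ k) :: complex)" if "y \<in> S" for k y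
      unfolding norm_mult norm_power norm_of_real using m(2)[OF that, of k] small[OF that] m0[of k] e
      by (auto simp: abs_mult intro!: mult_mono power_mono)
    moreover have "summable (\<lambda>k. of_real (m k * e ^ k) :: complex)"
      using m(1) by (rule summable_of_real)
    moreover have "range (\<lambda>k. of_real (m k * e ^ k) :: complex) \<subseteq> \<real>\<^sub>\<ge>\<^sub>0"
      using m0 e by (auto simp del: of_real_mult of_real_power)
    ultimately show "\<exists>d h. 0 < d \<and> summable h \<and> range h \<subseteq> \<real>\<^sub>\<ge>\<^sub>0 \<and>
       (\<forall>\<^sub>F k in sequentially. \<forall>y\<in>ball s d \<inter> S. norm (a k y * w y ^ k) \<le> norm (h k :: complex))"
      by (intro exI[of _ 1] exI[of _ "\<lambda>k. of_real (m k * e ^ k)"]) auto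
  qed
  then obtain g g' where g: "\<And>s. s \<in> S \<Longrightarrow> (\<lambda>k. a k s * w s ^ k) sums g s"
    and g': "\<And>s. s \<in> S \<Longrightarrow> (\<lambda>k. ?f' k s) sums g' s"
    and dg: "\<And>s. s \<in> S \<Longrightarrow> (g has_field_derivative g' s) (at s)" by blast
  have cv: "conv e (Abs_fps (\<lambda>k. a k s))" using maj s e by (rule majorized_conv)
  have "(\<lambda>k. fps_deriv (Abs_fps (\<lambda>k. a k s)) $ k * w s ^ k) sums
      eval_fps (fps_deriv (Abs_fps (\<lambda>k. a k s))) (w s)"
    using conv_deriv[OF cv] small[OF s] by (intro sums_eval_fps conv_less)
  then have "(\<lambda>k. of_nat (Suc k) * a (Suc k) s * w s ^ k * deriv w s) sums
      (eval_fps (fps_deriv (Abs_fps (\<lambda>k. a k s))) (w s) * deriv w s)"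
    by (intro sums_mult2) simp
  \<comment> \<open>At \<open>k = 0\<close> the truncated exponent \<open>k - 1\<close> is harmless
    because \<open>of_nat k\<close> vanishes; the index shift therefore loses no term.\<close>
  then have d2: "(\<lambda>k. a k s * (of_nat k * w s ^ (k - 1) * deriv w s)) sums
      (eval_fps (fps_deriv (Abs_fps (\<lambda>k. a k s))) (w s) * deriv w s)"
    using sums_Suc_imp[of "\<lambda>k. a k s * (of_nat k * w s ^ (k - 1) * deriv w s)"]
    by (simp add: mult_ac del: of_nat_Suc)
  \<comment> \<open>Convergence of this half comes for free, as the difference of two convergent
    series.\<close>
  have "(\<lambda>k. deriv (a k) s * w s ^ k) sums
      (g' s - eval_fps (fps_deriv (Abs_fps (\<lambda>k. a k s))) (w s) * deriv w s)"
    using sums_diff[OF g'[OF s] d2] by simp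
  then have "g' s = eval_fps (Abs_fps (\<lambda>k. deriv (a k) s)) (w s)
     + eval_fps (fps_deriv (Abs_fps (\<lambda>k. a k s))) (w s) * deriv w s"
    by (simp add: eval_fps_def sums_iff)
  moreover have "\<forall>\<^sub>F y in nhds s. g y = eval_fps (Abs_fps (\<lambda>k. a k y)) (w y)"
    using g by (intro eventually_nhds_in_open[OF S s, THEN eventually_mono])
      (simp add: eval_fps_def sums_iff)
  ultimately show ?thesis
    using dg[OF s] DERIV_cong_ev[OF refl _ refl] by metis
qed

section \<open>The second derivative of a function of a cubic root\<close>

text \<open>Since \<open>z\<^sub>q = 1 / (3 * z\<^sup>2 - P)\<close> for a root \<open>z\<close> of \<open>z^3 = P * z + Q\<close>, this is
  \<open>\<partial>\<^sub>q\<^sup>-\<^sup>1\<close> on power series in \<open>z\<close>.\<close>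

definition antider :: "complex \<Rightarrow> complex fps \<Rightarrow> complex fps" where
  "antider P F = fps_integral0 ((3 * fps_X ^ 2 - fps_const P) * F)"

lemma integral0_nth:
  "fps_integral0 F $ k = 1 / of_nat k * (if k < 1 then 0 else (F :: complex fps) $ (k - 1))"
  by (cases k) (auto simp: divide_simps simp del: of_nat_Suc)

text \<open>Integration together with the factors 1 and \<open>fps_X ^ 2\<close> shifts the index by
  1 and by 3. The conditionals reproduce \<open>shift\<close>, so that this is the coefficient in
  \<open>u_term\<close>.\<close>

lemma antider_nth:
  "antider P F $ k =
     1 / of_nat k * (- P * (if k < 1 then 0 else F $ (k - 1)) + 3 * (if k < 3 then 0 else F $ (k - 3)))"
proof -
  have *: "(3 * fps_X ^ 2 - fps_const P) * F = fps_const 3 * (fps_X ^ 2 * F) - fps_const P * F"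
    by (simp add: algebra_simps numeral_fps_const)
  show ?thesis
    unfolding antider_def integral0_nth * by (auto simp: fps_X_power_mult_nth numeral_3_eq_3)
qed

lemma deriv_antider: "fps_deriv (antider P F) = (3 * fps_X ^ 2 - fps_const P) * F"
  by (simp add: antider_def fps_deriv_fps_integral)

lemma conv_antider [intro]: "conv e F \<Longrightarrow> conv e (antider P F)"
  unfolding antider_def by (intro conv_intros)

lemma eval_linear:
  assumes "conv e F" "norm z < e"
  shows "eval_fps ((fps_const a * fps_X + fps_const c) * F) z = (a * z + c) * eval_fps F z"
proof -
  have "conv e (fps_const a * fps_X)" by auto
  then show ?thesis using assms
    by (simp add: eval_mult[of e] eval_add[of e] conv_add conv_const conv_fps_X)
qed

lemma eval_quadratic:
  assumes "conv e F" "norm z < e"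
  shows "eval_fps ((3 * fps_X ^ 2 - fps_const a) * F) z = (3 * z ^ 2 - a) * eval_fps F z"
proof -
  have "conv e (3 * fps_X ^ 2)" by auto
  then show ?thesis using assms
    by (simp add: eval_mult[of e] eval_diff[of e] conv_diff conv_const conv_power conv_numeral conv_fps_X)
qed

lemma eval_const_mult:
  assumes "conv e F" "norm z < e"
  shows "eval_fps (fps_const a * F) z = a * eval_fps F z"
  using assms by (simp add: eval_mult[of e] conv_const)

text \<open>One of the variables \<open>t\<close>, \<open>x\<close> is frozen and \<open>s\<close>
  stands for the other. The same computation then serves \<open>t\<close>- and
  \<open>x\<close>-derivatives alike.\<close>

locale cubic_series =
  fixes S :: "complex set" and e C :: real and P Q w :: "complex \<Rightarrow> complex"
    and \<beta> :: "nat \<Rightarrow> complex \<Rightarrow> complex"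
  assumes open_S: "open S" and e: "0 < e"
    and holo: "P holomorphic_on S" "Q holomorphic_on S" "w holomorphic_on S" "\<And>k. \<beta> k holomorphic_on S"
    and cubic: "\<And>s. s \<in> S \<Longrightarrow> w s ^ 3 = P s * w s + Q s"
    and simple_root: "\<And>s. s \<in> S \<Longrightarrow> 3 * w s ^ 2 - P s \<noteq> 0"
    and small: "\<And>s. s \<in> S \<Longrightarrow> norm (w s) < e"
    and bound_P: "\<And>s. s \<in> S \<Longrightarrow> norm (P s) \<le> C" "\<And>s. s \<in> S \<Longrightarrow> norm (deriv P s) \<le> C"
    and maj: "majorized e S \<beta>" "majorized e S (\<lambda>k. deriv (\<beta> k))"
       "majorized e S (\<lambda>k. deriv (deriv (\<beta> k)))"
begin

abbreviation "B s \<equiv> Abs_fps (\<lambda>k. \<beta> k s)"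
abbreviation "B1 s \<equiv> Abs_fps (\<lambda>k. deriv (\<beta> k) s)"
abbreviation "B2 s \<equiv> Abs_fps (\<lambda>k. deriv (deriv (\<beta> k)) s)"

text \<open>\<open>C1\<close> and \<open>C2\<close> are the first and second derivative of \<open>antider (P s) (B s)\<close> in the
  parameter \<open>s\<close>, taken coefficientwise.\<close>

definition c :: "nat \<Rightarrow> complex \<Rightarrow> complex" where
  "c k s = 1 / of_nat k * (- P s * (if k < 1 then 0 else \<beta> (k - 1) s) + 3 * (if k < 3 then 0 else \<beta> (k - 3) s))"

definition c1 :: "nat \<Rightarrow> complex \<Rightarrow> complex" where
  "c1 k s = 1 / of_nat k * (- P s * (if k < 1 then 0 else deriv (\<beta> (k - 1)) s) + 3 * (if k < 3 then 0 else deriv (\<beta> (k - 3)) s))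
     - deriv P s * (1 / of_nat k * (if k < 1 then 0 else \<beta> (k - 1) s))"

definition "C1 s = antider (P s) (B1 s) - fps_const (deriv P s) * fps_integral0 (B s)"

text \<open>The second summand is the chain rule term of \<open>antider (P s) (B s)\<close>: its
  factor \<open>3 * w s ^ 2 - P s\<close> times \<open>deriv w s\<close> is a linear polynomial in
  the root.\<close>

definition "U s = C1 s + (fps_const (deriv P s) * fps_X + fps_const (deriv Q s)) * B s"

definition "C2 s = antider (P s) (B2 s) - fps_const (2 * deriv P s) * fps_integral0 (B1 s)
     - fps_const (deriv (deriv P) s) * fps_integral0 (B s)"

text \<open>The part of the second derivative without a denominator. The factor 2 counts the
  \<open>B1\<close> term twice: it comes from \<open>C1\<close> along the root and from
  \<open>B\<close> in the parameter.\<close>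

definition "X s = C2 s + fps_const 2 * ((fps_const (deriv P s) * fps_X + fps_const (deriv Q s)) * B1 s)
     + (fps_const (deriv (deriv P) s) * fps_X + fps_const (deriv (deriv Q) s)) * B s"

text \<open>The numerator over \<open>3 * w s ^ 2 - P s\<close>. One linear factor is already
  present in the first derivative, the other comes from \<open>deriv w s\<close> when
  \<open>B\<close> is differentiated along the root.\<close>

definition "W s = (fps_const (deriv P s) * fps_X + fps_const (deriv Q s)) ^ 2 * fps_deriv (B s)"

lemma conv_B:
  assumes "s \<in> S" shows "conv e (B s)" "conv e (B1 s)" "conv e (B2 s)"
  using maj assms e by (auto intro: majorized_conv)

lemma conv_C1: "s \<in> S \<Longrightarrow> conv e (C1 s)"
  and conv_U: "s \<in> S \<Longrightarrow> conv e (U s)"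
  and conv_C2: "s \<in> S \<Longrightarrow> conv e (C2 s)"
  and conv_X: "s \<in> S \<Longrightarrow> conv e (X s)"
  and conv_W: "s \<in> S \<Longrightarrow> conv e (W s)"
  unfolding C1_def U_def C2_def X_def W_def by (intro conv_intros conv_antider conv_B; simp)+

text \<open>The coefficients are needed as functions of \<open>s\<close> for
  \<open>has_field_derivative_fps_family\<close>, and as power series for the algebra; these
  identities link the two forms.\<close>

lemma fps_c: "Abs_fps (\<lambda>k. c k s) = antider (P s) (B s)"
  by (rule fps_ext) (simp add: c_def antider_nth)

lemma fps_c1: "Abs_fps (\<lambda>k. c1 k s) = C1 s"
  by (rule fps_ext) (simp add: c1_def C1_def antider_nth integral0_nth)

lemmas holo' = holo[THEN holomorphic_deriv[OF _ open_S]]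

lemmas has_deriv = holo[THEN holomorphic_derivI[OF _ open_S]] holo'[THEN holomorphic_derivI[OF _ open_S]]

lemma holomorphic_c: "c k holomorphic_on S"
  unfolding c_def using holo
  by (cases "k < 1"; cases "k < 3") (auto intro!: holomorphic_intros simp del: One_nat_def)

lemma holomorphic_c1: "c1 k holomorphic_on S"
  unfolding c1_def using holo holo' open_S
  by (cases "k < 1"; cases "k < 3") (auto intro!: holomorphic_intros simp del: One_nat_def)

lemma deriv_c: "s \<in> S \<Longrightarrow> deriv (c k) s = c1 k s"
  unfolding c_def c1_def
  by (rule DERIV_imp_deriv; cases "k < 1"; cases "k < 3")
     (auto intro!: derivative_eq_intros has_deriv simp: field_simps simp del: One_nat_def)

lemma deriv_c1:
  assumes "s \<in> S" shows "deriv (c1 k) s = C2 s $ k"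
proof -
  have "(c1 k has_field_derivative
      1 / of_nat k * (- P s * (if k < 1 then 0 else deriv (deriv (\<beta> (k - 1))) s) + 3 * (if k < 3 then 0 else deriv (deriv (\<beta> (k - 3))) s))
     - 2 * deriv P s * (1 / of_nat k * (if k < 1 then 0 else deriv (\<beta> (k - 1)) s))
     - deriv (deriv P) s * (1 / of_nat k * (if k < 1 then 0 else \<beta> (k - 1) s))) (at s)"
    unfolding c1_def using assms
    by (cases "k < 1"; cases "k < 3")
      (auto intro!: derivative_eq_intros has_deriv simp: field_simps simp del: One_nat_def)
  from DERIV_imp_deriv[OF this] show ?thesis
    by (simp add: C2_def antider_nth integral0_nth)
qed

lemma norm_inverse_nat_le: "norm (1 / of_nat k :: complex) \<le> 1"
  by (cases k) (auto simp: norm_divide divide_simps simp del: of_nat_Suc)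

lemma majorized_frac: "majorized e S a \<Longrightarrow> majorized e S (\<lambda>k s. 1 / of_nat k * a k s)"
  by (rule majorized_mult[where C = 1]) (use norm_inverse_nat_le in auto)

lemma majorized_c: "majorized e S c"
  unfolding c_def
  by (intro majorized_frac majorized_add majorized_mult[where C = C] majorized_mult[where C = 3]
      majorized_shift maj) (use bound_P in auto)

lemma majorized_c1: "majorized e S c1"
  unfolding c1_def diff_conv_add_uminus mult_minus_left[symmetric]
  by (intro majorized_frac majorized_add majorized_mult[where C = C] majorized_mult[where C = 3]
      majorized_shift[where a = "\<lambda>k. deriv (\<beta> k)"] majorized_shift maj) (use bound_P in auto)

text \<open>Differentiate both sides of the cubic, which agree on the open set \<open>S\<close>. The
  form without division matches the factor in \<open>deriv_antider\<close>.\<close>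

lemma root_deriv:
  assumes "s \<in> S"
  shows "(3 * w s ^ 2 - P s) * deriv w s = deriv P s * w s + deriv Q s"
proof -
  have "((\<lambda>s. w s ^ 3) has_field_derivative 3 * w s ^ 2 * deriv w s) (at s)"
    using assms by (auto intro!: derivative_eq_intros has_deriv)
  moreover have "((\<lambda>s. P s * w s + Q s) has_field_derivative
     deriv P s * w s + P s * deriv w s + deriv Q s) (at s)"
    using assms by (auto intro!: derivative_eq_intros has_deriv)
  moreover have "\<forall>\<^sub>F y in nhds s. w y ^ 3 = P y * w y + Q y"
    using cubic by (intro eventually_nhds_in_open[OF open_S assms, THEN eventually_mono])
  ultimately have "3 * w s ^ 2 * deriv w s = deriv P s * w s + P s * deriv w s + deriv Q s"
    using DERIV_cong_ev[OF refl _ refl] DERIV_unique by metis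
  then show ?thesis by (simp add: algebra_simps)
qed

section \<open>First and second derivative along a slice\<close>

definition "v s = eval_fps (antider (P s) (B s)) (w s)"

text \<open>The value of \<open>U s\<close> at the root, with the linear factor kept outside the
  series so that the product rule applies to it.\<close>

definition "v1 s = eval_fps (C1 s) (w s) + (deriv P s * w s + deriv Q s) * eval_fps (B s) (w s)"

lemma v_has_derivative:
  assumes s: "s \<in> S"
  shows "(v has_field_derivative v1 s) (at s)"
proof -
  have "Abs_fps (\<lambda>k. deriv (c k) s) = C1 s"
    unfolding fps_c1[symmetric] using deriv_c[OF s] by simp
  then have "(v has_field_derivative eval_fps (C1 s) (w s) + (3 * w s ^ 2 - P s) * eval_fps (B s) (w s) * deriv w s) (at s)"
    using has_field_derivative_fps_family[OF open_S holomorphic_c holo(3) e majorized_c small s]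
      eval_quadratic[OF conv_B(1) small, OF s s]
    unfolding fps_c v_def[abs_def] deriv_antider by simp
  \<comment> \<open>Here the factor \<open>3 * w s ^ 2 - P s\<close> is absorbed together with
    \<open>deriv w s\<close>, so the first derivative has no denominator.\<close>
  then show ?thesis using root_deriv[OF s] unfolding v1_def
    by (metis mult.commute mult.left_commute)
qed

lemma v1_eq:
  assumes s: "s \<in> S"
  shows "v1 s = eval_fps (U s) (w s)"
proof -
  have "conv e ((fps_const (deriv P s) * fps_X + fps_const (deriv Q s)) * B s)"
    using conv_B(1)[OF s] by auto
  then show ?thesis
  unfolding v1_def U_def
  using s small conv_C1 conv_B(1) by (simp add: eval_add[of e] eval_linear[of e])
qed

text \<open>Differentiating the linear factor gives \<open>deriv P s * deriv w s\<close> times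
  \<open>B\<close>, and differentiating \<open>C1\<close> along the root gives the same term with
  the opposite sign. After this cancellation only \<open>W\<close> keeps a denominator.\<close>

lemma v1_has_derivative:
  assumes s: "s \<in> S"
  shows "(v1 has_field_derivative
     eval_fps (X s) (w s) + eval_fps (W s) (w s) / (3 * w s ^ 2 - P s)) (at s)"
proof -
  note [simp] = small[OF s]
  have "Abs_fps (\<lambda>k. deriv (c1 k) s) = C2 s"
    using deriv_c1[OF s] by (intro fps_ext) simp
  then have 1: "((\<lambda>s. eval_fps (C1 s) (w s)) has_field_derivative
     eval_fps (C2 s) (w s) + eval_fps (fps_deriv (C1 s)) (w s) * deriv w s) (at s)"
    using has_field_derivative_fps_family[OF open_S holomorphic_c1 holo(3) e majorized_c1 small s]
    unfolding fps_c1 by simp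
  have 2: "((\<lambda>s. eval_fps (B s) (w s)) has_field_derivative
     eval_fps (B1 s) (w s) + eval_fps (fps_deriv (B s)) (w s) * deriv w s) (at s)"
    by (rule has_field_derivative_fps_family[OF open_S holo(4,3) e maj(1) small s])
  have C1': "fps_deriv (C1 s) = (3 * fps_X ^ 2 - fps_const (P s)) * B1 s - fps_const (deriv P s) * B s"
    unfolding C1_def by (simp add: deriv_antider fps_deriv_fps_integral)
  have eC1': "eval_fps (fps_deriv (C1 s)) (w s) = (3 * w s ^ 2 - P s) * eval_fps (B1 s) (w s) - deriv P s * eval_fps (B s) (w s)"
    unfolding C1' using conv_B[OF s]
    by (subst eval_diff[of e]) (auto intro!: conv_intros simp: eval_quadratic[of e] eval_const_mult[of e])
  define L where "L = deriv P s * w s + deriv Q s"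
  have eX: "eval_fps (X s) (w s) = eval_fps (C2 s) (w s) + 2 * (L * eval_fps (B1 s) (w s))
     + (deriv (deriv P) s * w s + deriv (deriv Q) s) * eval_fps (B s) (w s)"
  proof -
    have "conv e ((fps_const (deriv P s) * fps_X + fps_const (deriv Q s)) * B1 s)"
      "conv e ((fps_const (deriv (deriv P) s) * fps_X + fps_const (deriv (deriv Q) s)) * B s)"
      "conv e (fps_const 2 * ((fps_const (deriv P s) * fps_X + fps_const (deriv Q s)) * B1 s))"
      "conv e (C2 s + fps_const 2 * ((fps_const (deriv P s) * fps_X + fps_const (deriv Q s)) * B1 s))"
      by (intro conv_intros conv_B conv_C2 s)+
    then show ?thesis
      unfolding X_def L_def using conv_B[OF s] conv_C2[OF s]
      by (simp add: eval_add[of e] eval_linear[of e] eval_const_mult[of e] del: fps_const_mult)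
  qed
  have eW: "eval_fps (W s) (w s) = L ^ 2 * eval_fps (fps_deriv (B s)) (w s)"
  proof -
    have "W s = (fps_const (deriv P s) * fps_X + fps_const (deriv Q s)) *
       ((fps_const (deriv P s) * fps_X + fps_const (deriv Q s)) * fps_deriv (B s))"
      by (simp add: W_def power2_eq_square mult.assoc)
    moreover have "conv e ((fps_const (deriv P s) * fps_X + fps_const (deriv Q s)) * fps_deriv (B s))"
      using conv_B[OF s] by auto
    ultimately show ?thesis using conv_B[OF s, THEN conv_deriv]
      by (simp add: eval_linear[of e] L_def power2_eq_square mult.assoc)
  qed
  let ?D = "3 * w s ^ 2 - P s"
  have w': "deriv w s = L / ?D"
    using root_deriv[OF s] simple_root[OF s] unfolding L_def by (simp add: field_simps)
  have "(v1 has_field_derivative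
     (eval_fps (C2 s) (w s) + eval_fps (fps_deriv (C1 s)) (w s) * deriv w s)
     + ((deriv (deriv P) s * w s + deriv P s * deriv w s + deriv (deriv Q) s) * eval_fps (B s) (w s)
       + L * (eval_fps (B1 s) (w s) + eval_fps (fps_deriv (B s)) (w s) * deriv w s))) (at s)"
    unfolding v1_def[abs_def] L_def
    by (rule derivative_eq_intros 1 2 has_deriv s refl | simp add: algebra_simps)+
  then show ?thesis
    unfolding eX eW eC1' w'
  proof (elim DERIV_cong)
    have "(x + (D * b1 - p1 * b) * (L / D)) + ((p2 * y + p1 * (L / D) + q2) * b + L * (b1 + b' * (L / D)))
       = x + 2 * (L * b1) + (p2 * y + q2) * b + L ^ 2 * b' / D" if "D \<noteq> 0"
      for x D b1 p1 b p2 y q2 b' :: complex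
      using that by (simp add: field_simps power2_eq_square)
    from this[OF simple_root[OF s]]
    show "(eval_fps (C2 s) (w s) + (?D * eval_fps (B1 s) (w s) - deriv P s * eval_fps (B s) (w s)) * (L / ?D))
     + ((deriv (deriv P) s * w s + deriv P s * (L / ?D) + deriv (deriv Q) s) * eval_fps (B s) (w s)
       + L * (eval_fps (B1 s) (w s) + eval_fps (fps_deriv (B s)) (w s) * (L / ?D)))
     = eval_fps (C2 s) (w s) + 2 * (L * eval_fps (B1 s) (w s))
     + (deriv (deriv P) s * w s + deriv (deriv Q) s) * eval_fps (B s) (w s)
     + L ^ 2 * eval_fps (fps_deriv (B s)) (w s) / ?D" .
  qed
qed

lemma deriv_v: "s \<in> S \<Longrightarrow> deriv v s = eval_fps (U s) (w s)"
  using v_has_derivative DERIV_imp_deriv v1_eq by metis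

lemma deriv2_v:
  assumes "s \<in> S"
  shows "deriv (deriv v) s = eval_fps (X s) (w s) + eval_fps (W s) (w s) / (3 * w s ^ 2 - P s)"
proof -
  have "\<forall>\<^sub>F y in nhds s. deriv v y = v1 y"
    using v_has_derivative DERIV_imp_deriv
    by (intro eventually_nhds_in_open[OF open_S assms, THEN eventually_mono]) blast
  then have "deriv (deriv v) s = deriv v1 s" by (intro deriv_cong_ev refl)
  then show ?thesis using v1_has_derivative[OF assms] DERIV_imp_deriv by metis
qed

end

section \<open>Holomorphic functions of two variables\<close>

text \<open>Composing the Frechet derivative with the two coordinate embeddings identifies its
  coefficients with the partial derivatives.\<close>

lemma holomorphic2_has_derivative:
  assumes f: "f holomorphic2_on N" and tx: "(t, x) \<in> N"
  shows "((\<lambda>s. f s x) has_field_derivative Dt f t x) (at t)"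
    and "((\<lambda>y. f t y) has_field_derivative Dx f t x) (at x)"
    and "((\<lambda>v. f (fst v) (snd v)) has_derivative (\<lambda>h. Dt f t x * fst h + Dx f t x * snd h)) (at (t, x))"
proof -
  obtain \<alpha> \<beta> where d: "((\<lambda>v. f (fst v) (snd v)) has_derivative (\<lambda>h. \<alpha> * fst h + \<beta> * snd h)) (at (t, x))"
    using f tx unfolding holomorphic2_on_def by blast
  have "((\<lambda>s. (s, x)) has_derivative (\<lambda>h. (h, 0))) (at t)"
    by (auto intro!: derivative_eq_intros)
  from has_derivative_compose[OF this d]
  have t: "((\<lambda>s. f s x) has_field_derivative \<alpha>) (at t)"
    by (simp add: has_field_derivative_def)
  have "((\<lambda>y. (t, y)) has_derivative (\<lambda>h. (0, h))) (at x)"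
    by (auto intro!: derivative_eq_intros)
  from has_derivative_compose[OF this d]
  have x: "((\<lambda>y. f t y) has_field_derivative \<beta>) (at x)"
    by (simp add: has_field_derivative_def)
  have "Dt f t x = \<alpha>" "Dx f t x = \<beta>"
    unfolding Dt_def Dx_def using t x DERIV_imp_deriv by blast+
  with t x d show "((\<lambda>s. f s x) has_field_derivative Dt f t x) (at t)"
    "((\<lambda>y. f t y) has_field_derivative Dx f t x) (at x)"
    "((\<lambda>v. f (fst v) (snd v)) has_derivative (\<lambda>h. Dt f t x * fst h + Dx f t x * snd h)) (at (t, x))"
    by simp_all
qed

lemma holomorphic2_slice:
  assumes "f holomorphic2_on N"
  shows "(\<And>s. s \<in> S \<Longrightarrow> (s, x) \<in> N) \<Longrightarrow> (\<lambda>s. f s x) holomorphic_on S"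
    and "(\<And>y. y \<in> S \<Longrightarrow> (t, y) \<in> N) \<Longrightarrow> (\<lambda>y. f t y) holomorphic_on S"
  unfolding holomorphic_on_def field_differentiable_def
  using holomorphic2_has_derivative[OF assms] by (meson has_field_derivative_at_within)+

lemma holomorphic2_subset: "f holomorphic2_on N \<Longrightarrow> M \<subseteq> N \<Longrightarrow> f holomorphic2_on M"
  unfolding holomorphic2_on_def by blast

lemma holomorphic2_imp_continuous_on:
  assumes "f holomorphic2_on N"
  shows "continuous_on N (\<lambda>w. f (fst w) (snd w))"
proof (rule continuous_at_imp_continuous_on, intro ballI)
  fix w assume "w \<in> N"
  then show "isCont (\<lambda>w. f (fst w) (snd w)) w"
    using holomorphic2_has_derivative(3)[OF assms, of "fst w" "snd w"] has_derivative_continuous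
    by auto
qed

text \<open>The filter \<open>nhds\<close> includes the point itself and factors by
  \<open>nhds_prod\<close>, which later yields a full product neighbourhood of the origin.\<close>

lemma holomorphic2_tendsto:
  assumes f: "f holomorphic2_on N" and N: "open N" "(t, x) \<in> N"
  shows "((\<lambda>w. f (fst w) (snd w)) \<longlongrightarrow> f t x) (nhds (t, x))"
proof -
  have "isCont (\<lambda>w. f (fst w) (snd w)) (t, x)"
    using holomorphic2_imp_continuous_on[OF f] N continuous_on_eq_continuous_at by blast
  then show ?thesis
    using tendsto_at_iff_tendsto_nhds[of "\<lambda>w. f (fst w) (snd w)" "(t, x)"] by (simp add: isCont_def)
qed

lemma holomorphic2_const: "(\<lambda>t x. c) holomorphic2_on N"
  unfolding holomorphic2_on_def by (auto intro!: exI[of _ 0])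

lemma holomorphic2_add:
  assumes "f holomorphic2_on N" "g holomorphic2_on N"
  shows "(\<lambda>t x. f t x + g t x) holomorphic2_on N"
  unfolding holomorphic2_on_def
proof
  fix w assume w: "w \<in> N"
  show "\<exists>\<alpha> \<beta>. ((\<lambda>v. f (fst v) (snd v) + g (fst v) (snd v)) has_derivative (\<lambda>h. \<alpha> * fst h + \<beta> * snd h)) (at w)"
    by (rule exI[of _ "Dt f (fst w) (snd w) + Dt g (fst w) (snd w)"],
        rule exI[of _ "Dx f (fst w) (snd w) + Dx g (fst w) (snd w)"])
      (use has_derivative_add[OF holomorphic2_has_derivative(3)[OF assms(1)] holomorphic2_has_derivative(3)[OF assms(2)],
         of "fst w" "snd w"] w in \<open>simp add: algebra_simps\<close>)
qed

lemma holomorphic2_mult: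
  assumes "f holomorphic2_on N" "g holomorphic2_on N"
  shows "(\<lambda>t x. f t x * g t x) holomorphic2_on N"
  unfolding holomorphic2_on_def
proof
  fix w assume w: "w \<in> N"
  show "\<exists>\<alpha> \<beta>. ((\<lambda>v. f (fst v) (snd v) * g (fst v) (snd v)) has_derivative (\<lambda>h. \<alpha> * fst h + \<beta> * snd h)) (at w)"
    by (rule exI[of _ "f (fst w) (snd w) * Dt g (fst w) (snd w) + Dt f (fst w) (snd w) * g (fst w) (snd w)"],
        rule exI[of _ "f (fst w) (snd w) * Dx g (fst w) (snd w) + Dx f (fst w) (snd w) * g (fst w) (snd w)"])
      (use has_derivative_mult[OF holomorphic2_has_derivative(3)[OF assms(1)] holomorphic2_has_derivative(3)[OF assms(2)],
         of "fst w" "snd w"] w in \<open>simp add: algebra_simps\<close>)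
qed

lemma holomorphic2_power:
  "f holomorphic2_on N \<Longrightarrow> (\<lambda>t x. f t x ^ n) holomorphic2_on N"
  by (induction n) (auto intro: holomorphic2_const holomorphic2_mult)

section \<open>Cauchy estimates, series of holomorphic functions and limits at the origin\<close>

lemma Cauchy_deriv_bound:
  assumes "g holomorphic_on S" "cball \<xi> r \<subseteq> S" "0 < r" "\<And>y. y \<in> cball \<xi> r \<Longrightarrow> norm (g y) \<le> M"
  shows "norm (deriv g \<xi>) \<le> M / r"
proof -
  have "norm ((deriv ^^ 1) g \<xi>) \<le> fact 1 * M / r ^ 1"
    using assms
    by (intro Cauchy_inequality)
      (auto intro: holomorphic_on_subset holomorphic_on_imp_continuous_on dest: subsetD[OF ball_subset_cball] simp: dist_norm)
  then show ?thesis by simp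
qed

text \<open>The Cauchy estimate costs the factor \<open>1 / r\<close>, which is the same for every
  index, so the majorant remains summable.\<close>

lemma majorized_deriv:
  assumes "majorized e S a" "\<And>k. a k holomorphic_on S" "0 < r" "\<And>\<xi>. \<xi> \<in> T \<Longrightarrow> cball \<xi> r \<subseteq> S"
  shows "majorized e T (\<lambda>k. deriv (a k))"
proof -
  from assms(1) obtain m where
    m: "summable (\<lambda>k. m k * e ^ k)" "\<And>k s. s \<in> S \<Longrightarrow> norm (a k s) \<le> m k"
    unfolding majorized_def by blast
  have "summable (\<lambda>k. m k / r * e ^ k)"
    using summable_divide[OF m(1), of r] by simp
  then show ?thesis
  proof (rule majorizedI)
    fix k \<xi> assume "\<xi> \<in> T"
    then show "norm (deriv (a k) \<xi>) \<le> m k / r"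
      using assms(2-4) m(2) by (intro Cauchy_deriv_bound[of _ S]) blast+
  qed
qed

text \<open>By uniform continuity on a compact polydisc, the slices of \<open>f\<close> at
  \<open>x\<close> and \<open>x0\<close> are uniformly close; a Cauchy estimate makes their
  \<open>t\<close>-derivatives close, uniformly in \<open>t\<close>. Continuity in \<open>t\<close>
  on the slice \<open>x0\<close> completes the argument.\<close>

lemma tendsto_Dt:
  assumes N: "open N" "(t0, x0) \<in> N" and f: "f holomorphic2_on N"
  shows "((\<lambda>w. Dt f (fst w) (snd w)) \<longlongrightarrow> Dt f t0 x0) (nhds (t0, x0))"
proof (rule tendstoI)
  fix \<epsilon> :: real assume \<epsilon>: "0 < \<epsilon>"
  obtain T X where "open T" "open X" "t0 \<in> T" "x0 \<in> X" and TX: "T \<times> X \<subseteq> N"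
    using N by (elim open_prod_elim) auto
  obtain \<rho> where \<rho>: "0 < \<rho>" "cball t0 \<rho> \<subseteq> T" using \<open>open T\<close> \<open>t0 \<in> T\<close> open_contains_cball by blast
  obtain \<sigma> where \<sigma>: "0 < \<sigma>" "cball x0 \<sigma> \<subseteq> X" using \<open>open X\<close> \<open>x0 \<in> X\<close> open_contains_cball by blast
  define r where "r = \<rho> / 2"
  have r: "0 < r" "cball t0 (2 * r) \<subseteq> T" using \<rho> by (auto simp: r_def)
  let ?K = "cball t0 (2 * r) \<times> cball x0 \<sigma>"
  have KN: "?K \<subseteq> N" using r \<sigma> TX by blast
  have "uniformly_continuous_on ?K (\<lambda>w. f (fst w) (snd w))"
    using holomorphic2_imp_continuous_on[OF f] KN
    by (intro compact_uniformly_continuous compact_Times) (auto intro: continuous_on_subset)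
  \<comment> \<open>The tolerance contains \<open>r\<close> because the Cauchy estimate on discs of
    radius \<open>r\<close> divides by it and should leave half of the error.\<close>
  then obtain d where d: "0 < d" and
    unif: "\<And>w w'. w \<in> ?K \<Longrightarrow> w' \<in> ?K \<Longrightarrow> dist w' w < d \<Longrightarrow>
        dist (f (fst w') (snd w')) (f (fst w) (snd w)) < \<epsilon> / 2 * r"
    unfolding uniformly_continuous_on_def using \<epsilon> r(1) by (metis half_gt_zero mult_pos_pos)
  have near: "norm (Dt f t x - Dt f t x0) \<le> \<epsilon> / 2" if t: "t \<in> ball t0 r" and x: "x \<in> ball x0 (min d \<sigma>)" for t x
  proof -
    have sub: "cball t r \<subseteq> cball t0 (2 * r)"
      using t by (auto simp: cball_subset_cball_iff dist_commute)
    have x0: "x \<in> cball x0 \<sigma>" "x0 \<in> cball x0 \<sigma>" using x \<sigma> by auto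
    have tN: "(t, x) \<in> N" "(t, x0) \<in> N" using t x0 KN r(1) by (auto simp: subset_iff)
    have h: "(\<lambda>s. f s x) holomorphic_on cball t0 (2 * r)" "(\<lambda>s. f s x0) holomorphic_on cball t0 (2 * r)"
      using x0 KN by (intro holomorphic2_slice(1)[OF f]; blast)+
    have "((\<lambda>s. f s x - f s x0) has_field_derivative Dt f t x - Dt f t x0) (at t)"
      using holomorphic2_has_derivative(1)[OF f] tN by (intro DERIV_diff)
    then have "deriv (\<lambda>s. f s x - f s x0) t = Dt f t x - Dt f t x0" by (rule DERIV_imp_deriv)
    moreover have "norm (deriv (\<lambda>s. f s x - f s x0) t) \<le> (\<epsilon> / 2 * r) / r"
    proof (rule Cauchy_deriv_bound[where S = "cball t0 (2 * r)"])
      show "(\<lambda>s. f s x - f s x0) holomorphic_on cball t0 (2 * r)"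
        using h by (rule holomorphic_on_diff)
      fix s assume "s \<in> cball t r"
      then have "dist (f s x) (f s x0) < \<epsilon> / 2 * r"
        using unif[of "(s, x0)" "(s, x)"] sub x0 x by (auto simp: dist_Pair_Pair dist_commute subset_iff)
      then show "norm (f s x - f s x0) \<le> \<epsilon> / 2 * r" by (simp add: dist_norm)
    qed (use r sub in auto)
    ultimately show ?thesis using r(1) by simp
  qed
  have "(\<lambda>s. f s x0) holomorphic_on T"
    using TX \<open>x0 \<in> X\<close> by (intro holomorphic2_slice(1)[OF f]) blast
  then have "continuous_on T (deriv (\<lambda>s. f s x0))"
    using \<open>open T\<close> by (intro holomorphic_on_imp_continuous_on holomorphic_deriv)
  then have "isCont (\<lambda>t. Dt f t x0) t0"
    unfolding Dt_def using \<open>open T\<close> \<open>t0 \<in> T\<close> by (simp add: continuous_on_eq_continuous_at)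
  then have "((\<lambda>t. Dt f t x0) \<longlongrightarrow> Dt f t0 x0) (nhds t0)"
    unfolding isCont_def using tendsto_at_iff_tendsto_nhds[of "\<lambda>t. Dt f t x0" t0] by simp
  then have "\<forall>\<^sub>F t in nhds t0. dist (Dt f t x0) (Dt f t0 x0) < \<epsilon> / 2"
    using \<epsilon> by (intro tendstoD) auto
  moreover have "\<forall>\<^sub>F t in nhds t0. t \<in> ball t0 r"
    using r(1) by (intro eventually_nhds_in_open) auto
  ultimately have 1: "\<forall>\<^sub>F t in nhds t0. dist (Dt f t x0) (Dt f t0 x0) < \<epsilon> / 2 \<and> t \<in> ball t0 r"
    by eventually_elim auto
  have 2: "\<forall>\<^sub>F x in nhds x0. x \<in> ball x0 (min d \<sigma>)"
    using d \<sigma> by (intro eventually_nhds_in_open) auto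
  show "\<forall>\<^sub>F w in nhds (t0, x0). dist (Dt f (fst w) (snd w)) (Dt f t0 x0) < \<epsilon>"
    unfolding nhds_prod eventually_prod_filter
  proof (intro exI conjI allI impI)
    fix t x assume "dist (Dt f t x0) (Dt f t0 x0) < \<epsilon> / 2 \<and> t \<in> ball t0 r" "x \<in> ball x0 (min d \<sigma>)"
    then have "dist (Dt f t x0) (Dt f t0 x0) < \<epsilon> / 2" "dist (Dt f t x) (Dt f t x0) \<le> \<epsilon> / 2"
      using near by (auto simp: dist_norm)
    then show "dist (Dt f (fst (t, x)) (snd (t, x))) (Dt f t0 x0) < \<epsilon>"
      using dist_triangle[of "Dt f t x" "Dt f t0 x0" "Dt f t x0"] by simp
  qed (fact 1 2)+
qed

text \<open>The bound depends on \<open>h\<close> alone, which gives uniform convergence of the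
  series of partial derivatives below.\<close>

lemma partial_sum_close:
  fixes a :: "nat \<Rightarrow> complex"
  assumes h: "summable h" and a: "\<And>k. norm (a k) \<le> h k"
  shows "norm (sum a {..<n} - suminf a) \<le> (\<Sum>i. h (i + n))"
proof -
  have sa: "summable a"
    using summable_comparison_test'[OF h, of 0 a] a by simp
  have sn: "summable (\<lambda>k. norm (a (k + n)))"
    using summable_comparison_test'[OF summable_ignore_initial_segment[OF h, of n], of 0 "\<lambda>k. norm (a (k + n))"] a by simp
  have "sum a {..<n} - suminf a = - (\<Sum>i. a (i + n))"
    using suminf_minus_initial_segment[OF sa, of n] by simp
  also have "norm \<dots> \<le> (\<Sum>i. norm (a (i + n)))"
    unfolding norm_minus_cancel by (rule summable_norm[OF sn])
  also have "\<dots> \<le> (\<Sum>i. h (i + n))"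
    by (rule suminf_le[OF a sn summable_ignore_initial_segment[OF h]])
  finally show ?thesis .
qed

text \<open>Cauchy estimates in each variable bound both partial derivatives of \<open>f k\<close>
  by \<open>h k / r\<close> near a point. The derivative series hence converges uniformly, and its
  sum is again complex-linear.\<close>

lemma holomorphic2_suminf:
  assumes D: "open D" and f: "\<And>k. f k holomorphic2_on D"
    and h: "summable h" and fh: "\<And>k t x. (t, x) \<in> D \<Longrightarrow> norm (f k t x) \<le> h k"
  shows "(\<lambda>t x. \<Sum>k. f k t x) holomorphic2_on D"
  unfolding holomorphic2_on_def
proof
  fix w0 assume "w0 \<in> D"
  then obtain \<rho> where \<rho>: "0 < \<rho>" "cball w0 \<rho> \<subseteq> D" using D open_contains_cball by blast
  define r where "r = \<rho> / 2"
  \<comment> \<open>Moving one coordinate of a point of \<open>ball w0 r\<close> by at most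
    \<open>r\<close> does not leave \<open>cball w0 (2 * r)\<close>.\<close>
  have r: "0 < r" "cball w0 (2 * r) \<subseteq> D" using \<rho> by (auto simp: r_def)
  let ?S = "ball w0 r"
  let ?f' = "\<lambda>k w h. Dt (f k) (fst w) (snd w) * fst h + Dx (f k) (fst w) (snd w) * snd h"
  let ?g' = "\<lambda>w h. (\<Sum>k. Dt (f k) (fst w) (snd w)) * fst h + (\<Sum>k. Dx (f k) (fst w) (snd w)) * snd h"
  have SD: "?S \<subseteq> D" using r by (auto simp: subset_iff)
  have box: "(s, snd w) \<in> D" if "w \<in> ?S" "s \<in> cball (fst w) r" for w s
  proof -
    have "dist w (s, snd w) \<le> r" using that by (cases w) (auto simp: dist_Pair_Pair)
    then have "dist w0 (s, snd w) \<le> 2 * r" using that(1) dist_triangle[of w0 "(s, snd w)" w] by simp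
    then show ?thesis using r by auto
  qed
  have box': "(fst w, s) \<in> D" if "w \<in> ?S" "s \<in> cball (snd w) r" for w s
  proof -
    have "dist w (fst w, s) \<le> r" using that by (cases w) (auto simp: dist_Pair_Pair)
    then have "dist w0 (fst w, s) \<le> 2 * r" using that(1) dist_triangle[of w0 "(fst w, s)" w] by simp
    then show ?thesis using r by auto
  qed
  have Dtb: "norm (Dt (f k) (fst w) (snd w)) \<le> h k / r" if "w \<in> ?S" for k w
    unfolding Dt_def using r(1) fh box[OF that] holomorphic2_slice(1)[OF f]
    by (intro Cauchy_deriv_bound[where S = "cball (fst w) r"]) blast+
  have Dxb: "norm (Dx (f k) (fst w) (snd w)) \<le> h k / r" if "w \<in> ?S" for k w
    unfolding Dx_def using r(1) fh box'[OF that] holomorphic2_slice(2)[OF f]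
    by (intro Cauchy_deriv_bound[where S = "cball (snd w) r"]) blast+
  have hr: "summable (\<lambda>k. h k / r)" using h by (rule summable_divide)
  have fsum: "summable (\<lambda>k. f k (fst w) (snd w))" if "w \<in> D" for w
    using fh[of "fst w" "snd w"] that by (intro summable_comparison_test'[OF h]) auto
  have "\<exists>g. \<forall>w\<in>?S. (\<lambda>k. f k (fst w) (snd w)) sums g w \<and> (g has_derivative ?g' w) (at w within ?S)"
  proof (rule has_derivative_series)
    show "convex ?S" by simp
    show "((\<lambda>w. f k (fst w) (snd w)) has_derivative ?f' k w) (at w within ?S)" if "w \<in> ?S" for k w
    proof (rule has_derivative_at_withinI)
      show "((\<lambda>w. f k (fst w) (snd w)) has_derivative ?f' k w) (at w)"
        using holomorphic2_has_derivative(3)[OF f, of "fst w" "snd w" k] that SD by auto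
    qed
    show "w0 \<in> ?S" using r by simp
    show "(\<lambda>k. f k (fst w0) (snd w0)) sums (\<Sum>k. f k (fst w0) (snd w0))"
      using fsum[OF \<open>w0 \<in> D\<close>] by (rule summable_sums)
    fix \<epsilon> :: real assume \<epsilon>: "0 < \<epsilon>"
    obtain n0 where n0: "\<And>n. n \<ge> n0 \<Longrightarrow> norm (\<Sum>i. h (i + n) / r) < \<epsilon> / 2"
      using suminf_exist_split[OF _ hr, of "\<epsilon> / 2"] \<epsilon> by auto
    show "\<forall>\<^sub>F n in sequentially. \<forall>w\<in>?S. \<forall>h. norm (sum (\<lambda>i. ?f' i w h) {..<n} - ?g' w h) \<le> \<epsilon> * norm h"
    proof (rule eventually_sequentiallyI[of n0], intro ballI allI)
      fix n w and v :: "complex \<times> complex" assume n: "n0 \<le> n" and w: "w \<in> ?S"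
      let ?A = "sum (\<lambda>k. Dt (f k) (fst w) (snd w)) {..<n} - (\<Sum>k. Dt (f k) (fst w) (snd w))"
      let ?B = "sum (\<lambda>k. Dx (f k) (fst w) (snd w)) {..<n} - (\<Sum>k. Dx (f k) (fst w) (snd w))"
      have A: "norm ?A \<le> \<epsilon> / 2" "norm ?B \<le> \<epsilon> / 2"
        using partial_sum_close[OF hr Dtb[OF w], of n] partial_sum_close[OF hr Dxb[OF w], of n] n0[OF n]
        by (auto simp: abs_less_iff)
      have eq: "sum (\<lambda>i. ?f' i w v) {..<n} - ?g' w v = ?A * fst v + ?B * snd v"
        by (simp add: algebra_simps sum.distrib sum_distrib_left)
      have "norm (?A * fst v + ?B * snd v) \<le> norm ?A * norm (fst v) + norm ?B * norm (snd v)"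
        by (rule order_trans[OF norm_triangle_ineq]) (simp add: norm_mult)
      also have "\<dots> \<le> \<epsilon> / 2 * norm v + \<epsilon> / 2 * norm v"
        using A \<epsilon> norm_fst_le[of "fst v" "snd v"] norm_snd_le[of "snd v" "fst v"]
        by (intro add_mono mult_mono) auto
      finally show "norm (sum (\<lambda>i. ?f' i w v) {..<n} - ?g' w v) \<le> \<epsilon> * norm v"
        unfolding eq by simp
    qed
  qed
  then obtain g where g: "\<And>w. w \<in> ?S \<Longrightarrow> (\<lambda>k. f k (fst w) (snd w)) sums g w"
    and dg: "\<And>w. w \<in> ?S \<Longrightarrow> (g has_derivative ?g' w) (at w within ?S)" by blast
  have w0: "w0 \<in> ?S" using r by simp
  have "(g has_derivative ?g' w0) (at w0)"
    using dg[OF w0] w0 by (simp add: at_within_open[of w0 ?S])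
  then have "((\<lambda>w. \<Sum>k. f k (fst w) (snd w)) has_derivative ?g' w0) (at w0)"
    by (rule has_derivative_transform_within_open[OF _ open_ball w0]) (use g sums_unique in blast)
  then show "\<exists>\<alpha> \<beta>. ((\<lambda>v. \<Sum>k. f k (fst v) (snd v)) has_derivative (\<lambda>h. \<alpha> * fst h + \<beta> * snd h)) (at w0)"
    by blast
qed

text \<open>Tannery's theorem: as \<open>P\<close> tends to 0, only the term with
  \<open>k = 0\<close> survives. Each entry of \<open>matM\<close> is a constant multiple of such a
  sum.\<close>

lemma sparse_sum_tendsto:
  fixes P g :: "'w \<Rightarrow> complex" and a :: "nat \<Rightarrow> 'w \<Rightarrow> complex" and n :: "nat \<Rightarrow> complex"
  assumes F: "F \<noteq> bot" and P: "(P \<longlongrightarrow> 0) F" and g: "(g \<longlongrightarrow> g0) F" and a: "\<And>k. (a k \<longlongrightarrow> l k) F"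
    and n: "\<And>k. norm (n k) \<le> 2 * real k + 2"
    and e: "0 < e" and maj: "majorized e S a" and S: "\<forall>\<^sub>F w in F. w \<in> S"
  shows "((\<lambda>w. \<Sum>k. (P w / 3) ^ k * n k * g w * a (2 * k + i) w) \<longlongrightarrow> n 0 * g0 * l i) F"
proof -
  obtain m where m: "summable (\<lambda>k. m k * e ^ k)" "\<And>k s. s \<in> S \<Longrightarrow> norm (a k s) \<le> m k"
    using maj unfolding majorized_def by blast
  obtain s0 where "s0 \<in> S" using S F eventually_happens by blast
  then have m0: "0 \<le> m k" for k using m(2) norm_ge_zero order_trans by blast
  have "summable ((\<lambda>k. m k * e ^ k) \<circ> (\<lambda>k. 2 * k + i))"
    using m0 e by (intro summable_reindex m(1)) (auto simp: inj_on_def)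
  then have sm: "summable (\<lambda>k. 2 * (norm g0 + 1) / e ^ i * (m (2 * k + i) * e ^ (2 * k + i)))"
    by (intro summable_mult) (simp add: o_def)
  \<comment> \<open>This makes \<open>norm (P w / 3)\<close> less than a quarter of
    \<open>e ^ 2\<close>; the spare \<open>4 ^ k\<close> absorbs the linear growth of
    \<open>n k\<close>.\<close>
  have "\<forall>\<^sub>F w in F. norm (P w) < 3 * e\<^sup>2 / 4"
    using P e by (intro order_tendstoD(2)[OF tendsto_norm_zero]) auto
  moreover have "\<forall>\<^sub>F w in F. norm (g w) < norm g0 + 1"
    using g by (intro order_tendstoD(2)[OF tendsto_norm]) auto
  ultimately have ev: "\<forall>\<^sub>F w in F. norm (P w) < 3 * e\<^sup>2 / 4 \<and> norm (g w) < norm g0 + 1 \<and> w \<in> S"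
    using S by eventually_elim auto
  have bound: "norm ((P w / 3) ^ k * n k * g w * a (2 * k + i) w)
      \<le> 2 * (norm g0 + 1) / e ^ i * (m (2 * k + i) * e ^ (2 * k + i))"
    if w: "norm (P w) < 3 * e\<^sup>2 / 4 \<and> norm (g w) < norm g0 + 1 \<and> w \<in> S" for k w
  proof -
    have "norm (P w / 3) ^ k \<le> (e\<^sup>2 / 4) ^ k"
      using w by (intro power_mono) (auto simp: norm_divide)
    then have "norm (P w / 3) ^ k * norm (n k) \<le> (e\<^sup>2 / 4) ^ k * (2 * real k + 2)"
      using n by (intro mult_mono) auto
    also have "real k + 1 \<le> 4 ^ k"
      by (induction k) auto
    then have "(e\<^sup>2 / 4) ^ k * (2 * real k + 2) \<le> (e\<^sup>2 / 4) ^ k * (2 * 4 ^ k)"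
      using e by (intro mult_left_mono) auto
    also have "\<dots> = 2 * e ^ (2 * k)"
      by (simp add: power_divide power_mult)
    finally have *: "norm (P w / 3) ^ k * norm (n k) \<le> 2 * e ^ (2 * k)" .
    have "norm (P w / 3) ^ k * norm (n k) * norm (g w) * norm (a (2 * k + i) w)
       \<le> 2 * e ^ (2 * k) * (norm g0 + 1) * m (2 * k + i)"
      using w m(2)[of w "2 * k + i"] e by (intro mult_mono[OF mult_mono[OF *]]) auto
    also have "\<dots> = 2 * (norm g0 + 1) / e ^ i * (m (2 * k + i) * e ^ (2 * k + i))"
      using e by (simp add: power_add field_simps)
    finally show ?thesis by (simp add: norm_mult norm_power)
  qed
  have "((\<lambda>w. \<Sum>k. (P w / 3) ^ k * n k * g w * a (2 * k + i) w)
      \<longlongrightarrow> (\<Sum>k. (0 / 3) ^ k * n k * g0 * l (2 * k + i))) F"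
  proof (rule tannerys_theorem[THEN conjunct2, THEN conjunct2, OF _ _ sm F])
    show "((\<lambda>w. (P w / 3) ^ k * n k * g w * a (2 * k + i) w) \<longlongrightarrow> (0 / 3) ^ k * n k * g0 * l (2 * k + i)) F" for k
      by (intro tendsto_intros P g a) auto
    show "\<forall>\<^sub>F (k, w) in sequentially \<times>\<^sub>F F. norm ((P w / 3) ^ k * n k * g w * a (2 * k + i) w)
       \<le> 2 * (norm g0 + 1) / e ^ i * (m (2 * k + i) * e ^ (2 * k + i))"
      unfolding eventually_prod_filter
      by (rule exI[of _ "\<lambda>_. True"], rule exI[of _ "\<lambda>w. norm (P w) < 3 * e\<^sup>2 / 4 \<and> norm (g w) < norm g0 + 1 \<and> w \<in> S"])
        (use ev bound in auto)
  qed
  \<comment> \<open>Here \<open>0 ^ 0 = 1\<close> retains the first term.\<close>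
  moreover have "(\<Sum>k. (0 / 3) ^ k * n k * g0 * l (2 * k + i)) = n 0 * g0 * l i"
    using powser_zero[of "\<lambda>k. n k * g0 * l (2 * k + i)"] by (simp add: mult_ac)
  ultimately show ?thesis by simp
qed

text \<open>Since \<open>matrix_inv\<close> is defined by choice, the nonzero determinant is what
  makes the fixed point equation a genuine linear system.\<close>

lemma matrix_inv_solve:
  fixes A :: "complex ^ 2 ^ 2"
  assumes "det A \<noteq> 0" "v = matrix_inv A *v r"
  shows "A *v v = r"
proof -
  have "invertible A" using assms(1) invertible_det_nz by blast
  then have "A ** matrix_inv A = mat 1"
    unfolding matrix_inv_def invertible_def by (rule someI2_ex) simp
  then show ?thesis using assms(2) by (simp add: matrix_vector_mul_assoc)
qed

section \<open>Coefficients and the factorisation at the double root\<close>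

text \<open>The factor \<open>1 - 1 / of_nat k\<close> combines \<open>fps_X * B s\<close> with the
  integral of \<open>B s\<close> subtracted in \<open>C1\<close>. The conditionals are those of
  \<open>shift\<close>, so the result can be matched with \<open>coefU\<close>.\<close>

lemma (in cubic_series) U_nth:
  "U s $ k = (1 - 1 / of_nat k) * deriv P s * (if k < 1 then 0 else \<beta> (k - 1) s) + deriv Q s * \<beta> k s
     + 1 / of_nat k * (- P s * (if k < 1 then 0 else deriv (\<beta> (k - 1)) s)
       + 3 * (if k < 3 then 0 else deriv (\<beta> (k - 3)) s))"
  unfolding U_def C1_def
  by (auto simp: antider_nth integral0_nth distrib_right mult.assoc fps_X_mult_nth algebra_simps)

lemma (in cubic_series) X_nth:
  "X s $ k = (2 - 2 / of_nat k) * (if k < 1 then 0 else deriv (\<beta> (k - 1)) s) * deriv P s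
     + (1 - 1 / of_nat k) * (if k < 1 then 0 else \<beta> (k - 1) s) * deriv (deriv P) s
     + \<beta> k s * deriv (deriv Q) s + 2 * deriv (\<beta> k) s * deriv Q s
     + 1 / of_nat k * (- P s * (if k < 1 then 0 else deriv (deriv (\<beta> (k - 1))) s)
       + 3 * (if k < 3 then 0 else deriv (deriv (\<beta> (k - 3))) s))"
proof -
  have X: "X s = C2 s + (fps_const (2 * deriv P s) * (fps_X * B1 s) + fps_const (2 * deriv Q s) * B1 s)
     + (fps_const (deriv (deriv P) s) * (fps_X * B s) + fps_const (deriv (deriv Q) s) * B s)"
    unfolding X_def fps_const_mult[symmetric] by (simp add: algebra_simps del: fps_const_mult)
  show ?thesis
    unfolding X C2_def by (simp add: antider_nth integral0_nth fps_X_mult_nth algebra_simps)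
qed

lemma (in cubic_series) W_nth:
  "W s $ k = (of_nat k - 1) * (deriv P s)\<^sup>2 * (if k < 1 then 0 else \<beta> (k - 1) s)
     + 2 * of_nat k * deriv P s * deriv Q s * \<beta> k s
     + (of_nat k + 1) * (deriv Q s)\<^sup>2 * \<beta> (k + 1) s"
proof -
  have sq: "(a * x + d) ^ 2 * f = a * a * (x * (x * f)) + 2 * (a * d) * (x * f) + d * d * f"
    for a d x f :: "complex fps"
    by (simp add: power2_eq_square algebra_simps)
  have "W s = fps_const ((deriv P s)\<^sup>2) * (fps_X * (fps_X * fps_deriv (B s)))
      + fps_const (2 * (deriv P s * deriv Q s)) * (fps_X * fps_deriv (B s))
      + fps_const ((deriv Q s)\<^sup>2) * fps_deriv (B s)"
    unfolding W_def sq by (simp only: numeral_fps_const fps_const_mult power2_eq_square)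
  then have W: "W s $ k = (deriv P s)\<^sup>2 * (fps_X * (fps_X * fps_deriv (B s))) $ k
      + 2 * (deriv P s * deriv Q s) * (fps_X * fps_deriv (B s)) $ k
      + (deriv Q s)\<^sup>2 * fps_deriv (B s) $ k"
    by (simp only: fps_add_nth fps_mult_left_const_nth)
  have X1: "(fps_X * fps_deriv (B s)) $ j = of_nat j * \<beta> j s" for j
    by (cases j) (simp_all add: fps_X_mult_nth)
  have X2: "(fps_X * (fps_X * fps_deriv (B s))) $ k = (of_nat k - 1) * (if k < 1 then 0 else \<beta> (k - 1) s)"
    using X1 by (cases k) (simp_all add: fps_X_mult_nth[of "fps_X * fps_deriv (B s)"])
  have X0: "fps_deriv (B s) $ k = (of_nat k + 1) * \<beta> (k + 1) s"
    by simp
  show ?thesis unfolding W X0 X1 X2 by (simp only: mult_ac)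
qed

text \<open>Powers of \<open>P / 3\<close> are even powers of a square root of norm less than
  \<open>e\<close>. The sum is thus a subseries of an absolutely convergent power series.\<close>

lemma conv_sparse_summable:
  assumes F: "conv e F" and P: "norm (P / 3) < e\<^sup>2" and e: "0 < e"
  shows "summable (\<lambda>j. F $ (i + 2 * j) * (P / 3) ^ j)"
proof -
  let ?\<zeta> = "csqrt (P / 3)"
  have z2: "?\<zeta> ^ 2 = P / 3" by simp
  have "norm ?\<zeta> ^ 2 < e ^ 2" using P by (simp only: norm_power[symmetric] z2)
  then have z: "norm ?\<zeta> < e" using power2_less_imp_less e less_imp_le by blast
  have "conv e (fps_shift i F)" using F by (rule conv_shift)
  from conv_less[OF this z] have "summable (\<lambda>n. norm (fps_shift i F $ n * ?\<zeta> ^ n))"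
    by (intro abs_summable_in_conv_radius) (simp add: fps_conv_radius_def)
  then have "summable ((\<lambda>n. norm (fps_shift i F $ n * ?\<zeta> ^ n)) \<circ> (\<lambda>j. 2 * j))"
    by (rule summable_reindex) (auto simp: inj_on_def)
  then have "summable (\<lambda>j. norm (F $ (i + 2 * j) * (P / 3) ^ j))"
    by (simp add: o_def power_mult add.commute)
  then show ?thesis by (rule summable_norm_cancel)
qed

text \<open>The two vanishing sums say that the power series \<open>A\<close> vanishes at both square roots of \<open>P/3\<close>.\<close>

lemma eval_factor:
  assumes A: "conv e A" and C: "conv e C" and P: "norm (P / 3) < e\<^sup>2" and z: "norm z < e"
    and ev: "(\<Sum>j. A $ (2 * j) * (P / 3) ^ j) = 0" and od: "(\<Sum>j. A $ (1 + 2 * j) * (P / 3) ^ j) = 0"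
    and C_nth: "\<And>k. C $ k = (\<Sum>j. A $ (k + 2 + 2 * j) * (P / 3) ^ j)"
  shows "eval_fps A z = (z ^ 2 - P / 3) * eval_fps C z"
proof -
  have e: "0 < e" using z norm_ge_zero[of z] by linarith
  \<comment> \<open>Splitting off \<open>j = 0\<close> leaves \<open>P / 3\<close> times the sum
    that defines \<open>C $ i\<close>.\<close>
  have split: "(\<Sum>j. A $ (i + 2 * j) * (P / 3) ^ j) = A $ i + P / 3 * C $ i" for i
  proof -
    have "(\<Sum>j. A $ (i + 2 * j) * (P / 3) ^ j)
        = (\<Sum>j. A $ (i + 2 * Suc j) * (P / 3) ^ Suc j) + A $ i"
      using suminf_split_head[OF conv_sparse_summable[OF A P e, of i]] by simp
    also have "(\<Sum>j. A $ (i + 2 * Suc j) * (P / 3) ^ Suc j) = (\<Sum>j. P / 3 * (A $ (i + 2 + 2 * j) * (P / 3) ^ j))"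
      by (simp add: mult_ac)
    also have "\<dots> = P / 3 * C $ i"
      unfolding C_nth by (rule suminf_mult[OF conv_sparse_summable[OF A P e]])
    finally show ?thesis by simp
  qed
  have "A = fps_X ^ 2 * C - fps_const (P / 3) * C"
  proof (rule fps_ext)
    fix k :: nat
    \<comment> \<open>The first two coefficients use \<open>ev\<close> and \<open>od\<close>. For
      larger \<open>k\<close> the sum in \<open>split\<close> is itself
      \<open>C $ (k - 2)\<close>.\<close>
    consider "k = 0" | "k = 1" | "2 \<le> k" by linarith
    then show "A $ k = (fps_X ^ 2 * C - fps_const (P / 3) * C) $ k"
    proof cases
      case 1 then show ?thesis using split[of 0] ev by (simp add: fps_X_power_mult_nth eq_neg_iff_add_eq_0)
    next
      case 2 then show ?thesis using split[of 1] od by (simp add: fps_X_power_mult_nth eq_neg_iff_add_eq_0)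
    next
      case 3
      then have "C $ (k - 2) = A $ k + P / 3 * C $ k"
        using split[of k] C_nth[of "k - 2"] by (simp only: le_add_diff_inverse2)
      then show ?thesis using 3 by (simp add: fps_X_power_mult_nth)
    qed
  qed
  moreover have "conv e (fps_X ^ 2 * C)" "conv e (fps_const (P / 3) * C)" "conv e (fps_X ^ 2)"
    using C by (auto intro: conv_intros)
  ultimately show ?thesis
    using C z by (simp add: eval_diff[of e] eval_mult[of e] conv_const left_diff_distrib)
qed

text \<open>Each of the two derivatives costs a Cauchy estimate of radius \<open>R\<close>, hence
  the discs of radius \<open>3 * R\<close>, \<open>2 * R\<close> and \<open>R\<close>. The constant
  covers the bound 1 for \<open>P\<close> and the bound \<open>1 / R\<close> for its
  derivative.\<close>

lemma cubic_series_polydisc_slice: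
  assumes R: "0 < R" and e: "0 < e" and S: "open S" "S \<subseteq> ball 0 R"
    and holo: "P holomorphic_on ball 0 (3 * R)" "Q holomorphic_on ball 0 (3 * R)"
      "\<And>k. \<beta> k holomorphic_on ball 0 (3 * R)" "w holomorphic_on S"
    and P: "\<And>s. s \<in> ball 0 (3 * R) \<Longrightarrow> norm (P s) \<le> 1"
    and maj: "majorized e (ball 0 (3 * R)) \<beta>"
    and root: "\<And>s. s \<in> S \<Longrightarrow> w s ^ 3 = P s * w s + Q s"
      "\<And>s. s \<in> S \<Longrightarrow> 3 * w s ^ 2 - P s \<noteq> 0" "\<And>s. s \<in> S \<Longrightarrow> norm (w s) < e"
  shows "cubic_series S e (max 1 (1 / R)) P Q w \<beta>"
proof -
  have sub: "S \<subseteq> ball 0 (3 * R)" using S R by (auto simp: subset_iff)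
  have cb: "cball \<xi> R \<subseteq> ball 0 (3 * R)" if "\<xi> \<in> ball 0 (2 * R)" for \<xi> :: complex
    using that by (auto simp: cball_subset_ball_iff dist_commute)
  have cb': "cball \<xi> R \<subseteq> ball 0 (2 * R)" if "\<xi> \<in> ball 0 R" for \<xi> :: complex
    using that by (auto simp: cball_subset_ball_iff dist_commute)
  have d1: "majorized e (ball 0 (2 * R)) (\<lambda>k. deriv (\<beta> k))"
    by (rule majorized_deriv[OF maj holo(3) R cb])
  have d2: "majorized e (ball 0 R) (\<lambda>k. deriv (deriv (\<beta> k)))"
    by (rule majorized_deriv[OF d1 _ R cb'])
      (use R in \<open>auto intro!: holomorphic_deriv holomorphic_on_subset[OF holo(3)] simp: subset_iff\<close>)
  show ?thesis
  proof
    show "norm (P s) \<le> max 1 (1 / R)" if "s \<in> S" for s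
      using P[of s] that sub by fastforce
    show "norm (deriv P s) \<le> max 1 (1 / R)" if "s \<in> S" for s
    proof -
      have "s \<in> ball 0 (2 * R)" using that S(2) R by (auto simp: subset_iff)
      then have "cball s R \<subseteq> ball 0 (3 * R)" by (rule cb)
      then have "norm (deriv P s) \<le> 1 / R"
        using holo(1) R P by (intro Cauchy_deriv_bound[of P "ball 0 (3 * R)"]) auto
      then show ?thesis by simp
    qed
    show "majorized e S (\<lambda>k. deriv (\<beta> k))"
      using d1 by (rule majorized_subset) (use S R in \<open>auto simp: subset_iff\<close>)
  qed (use assms sub in \<open>auto intro: holomorphic_on_subset majorized_subset majorized_subset[OF d2]\<close>)
qed

section \<open>The fixed point solves the equation\<close>

lemma shift_eq:
  "shift b i j t x = (if j < i then 0 else b (j - i) t x)"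
  "Dt (shift b i j) t x = (if j < i then 0 else Dt (b (j - i)) t x)"
  "Dx (shift b i j) t x = (if j < i then 0 else Dx (b (j - i)) t x)"
  "Dt (Dt (shift b i j)) t x = (if j < i then 0 else Dt (Dt (b (j - i))) t x)"
  "Dx (Dx (shift b i j)) t x = (if j < i then 0 else Dx (Dx (b (j - i))) t x)"
  by (simp_all add: shift_def Dt_def[abs_def] Dx_def[abs_def])

lemma u_term_eq: "u_term p b z t x k = antider (p t x) (Abs_fps (\<lambda>k. b k t x)) $ k * z t x ^ k"
  by (simp add: u_term_def shift_eq antider_nth)

lemma u_fun_eq: "u_fun p b z t x = eval_fps (antider (p t x) (Abs_fps (\<lambda>k. b k t x))) (z t x)"
  by (simp add: u_fun_def u_term_eq[abs_def] eval_fps_def)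

text \<open>If \<open>norm z\<close> were at least \<open>e\<close>, both terms on the right of the
  cubic would be dominated by half of \<open>norm z ^ 3\<close>, one of them strictly. The bound
  holds for every branch.\<close>

lemma cubic_root_small:
  assumes z: "(z :: complex) ^ 3 = P * z + Q" and P: "norm P < e\<^sup>2 / 2" and Q: "norm Q < e ^ 3 / 2" and e: "0 < e"
  shows "norm z < e"
proof (rule ccontr)
  assume "\<not> norm z < e"
  then have z_ge: "e \<le> norm z" by simp
  have "norm z ^ 3 \<le> norm P * norm z + norm Q"
    unfolding norm_power[symmetric] z using norm_triangle_ineq[of "P * z" Q] by (simp add: norm_mult)
  also have "\<dots> < norm z ^ 2 / 2 * norm z + norm z ^ 3 / 2"
  proof (rule add_le_less_mono)
    have "norm P \<le> norm z ^ 2 / 2"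
      using P power_mono[OF z_ge less_imp_le[OF e], of 2] by linarith
    then show "norm P * norm z \<le> norm z ^ 2 / 2 * norm z" by (rule mult_right_mono) simp
    show "norm Q < norm z ^ 3 / 2"
      using Q power_mono[OF z_ge less_imp_le[OF e], of 3] by linarith
  qed
  also have "\<dots> = norm z ^ 3" by (simp add: power2_eq_square power3_eq_cube)
  finally show False by simp
qed

text \<open>At a multiple root \<open>P\<close> is three times \<open>z ^ 2\<close> and
  \<open>Q = - 2 * z ^ 3\<close>, which makes the discriminant zero.\<close>

lemma simple_cubic_root:
  assumes z: "(z :: complex) ^ 3 = P * z + Q" and disc: "4 * P ^ 3 - 27 * Q\<^sup>2 \<noteq> 0"
  shows "3 * z\<^sup>2 - P \<noteq> 0"
proof
  assume "3 * z\<^sup>2 - P = 0"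
  then have P: "P = 3 * z\<^sup>2" by simp
  then have "Q = - 2 * z ^ 3" using z by (simp add: power2_eq_square power3_eq_cube eq_neg_iff_add_eq_0 algebra_simps)
  with P disc show False by (simp add: power_mult_distrib flip: power_mult)
qed

lemma matM_mult_vec:
  fixes v1 v2 :: complex
  assumes "matM p q b t x *v vector [v1, v2] = rhsB p q b t x"
  shows "4 * (\<Sum>k. (p t x / 3) ^ k * of_nat k * Dt q t x * b (2 * k) t x) * v1
      + (\<Sum>k. (p t x / 3) ^ k * of_nat (2 * k + 1) * Dt q t x * b (2 * k + 1) t x) * v2
      = (\<Sum>k. (p t x / 3) ^ k * calB p q b (2 * k) t x)"
    and "2 * (\<Sum>k. (p t x / 3) ^ k * of_nat (2 * k + 1) * Dt q t x * b (2 * k + 1) t x) * v1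
      + 2 * (\<Sum>k. (p t x / 3) ^ k * of_nat (k + 1) * Dt q t x * b (2 * k + 2) t x) * v2
      = (\<Sum>k. (p t x / 3) ^ k * calB p q b (2 * k + 1) t x)"
  using arg_cong[OF assms, of "\<lambda>v. vec_nth v 1"] arg_cong[OF assms, of "\<lambda>v. vec_nth v 2"]
  unfolding matM_def rhsB_def matrix_vector_mult_def
  by (simp_all only: vec_lambda_beta sum_2 vector_2)

text \<open>In the limit the rows of the matrix are \<open>[0, 1]\<close> and
  \<open>[2, 0]\<close>.\<close>

lemma det_matM_tendsto:
  assumes p: "p holomorphic2_on N" and q: "q holomorphic2_on N" and b: "\<And>k. b k holomorphic2_on N"
    and N: "open N" "(0, 0) \<in> N" and e: "0 < e"
    and maj: "majorized e N (\<lambda>k w. b k (fst w) (snd w))"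
    and init: "p 0 0 = 0" "Dt q 0 0 = 1" "b 1 0 0 = 1" "b 2 0 0 = 0"
  shows "((\<lambda>w. det (matM p q b (fst w) (snd w))) \<longlongrightarrow> - 2) (nhds (0, 0))"
proof -
  note cont = holomorphic2_tendsto[OF _ N]
  have F: "nhds (0 :: complex, 0 :: complex) \<noteq> bot" by simp
  have pq: "((\<lambda>w. p (fst w) (snd w)) \<longlongrightarrow> 0) (nhds (0, 0))"
    "((\<lambda>w. Dt q (fst w) (snd w)) \<longlongrightarrow> 1) (nhds (0, 0))"
    using cont[OF p] tendsto_Dt[OF N q] init by simp_all
  have evN: "\<forall>\<^sub>F w in nhds (0, 0). w \<in> N" using N by (rule eventually_nhds_in_open)
  note T = sparse_sum_tendsto[OF F pq cont[OF b] _ e maj evN]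
  have m11: "((\<lambda>w. \<Sum>k. (p (fst w) (snd w) / 3) ^ k * of_nat k * Dt q (fst w) (snd w) * b (2 * k) (fst w) (snd w))
     \<longlongrightarrow> 0) (nhds (0, 0))"
    using T[of of_nat 0] by simp
  have m12: "((\<lambda>w. \<Sum>k. (p (fst w) (snd w) / 3) ^ k * of_nat (2 * k + 1) * Dt q (fst w) (snd w) * b (2 * k + 1) (fst w) (snd w))
     \<longlongrightarrow> 1) (nhds (0, 0))"
    using T[of "\<lambda>k. of_nat (2 * k + 1)" 1] init(3) unfolding norm_of_nat by simp
  have m22: "((\<lambda>w. \<Sum>k. (p (fst w) (snd w) / 3) ^ k * of_nat (k + 1) * Dt q (fst w) (snd w) * b (2 * k + 2) (fst w) (snd w))
     \<longlongrightarrow> 0) (nhds (0, 0))"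
    using T[of "\<lambda>k. of_nat (k + 1)" 2] init(4) unfolding norm_of_nat by simp
  have "((\<lambda>w. det (matM p q b (fst w) (snd w))) \<longlongrightarrow> (4 * 0) * (2 * 0) - 1 * (2 * 1)) (nhds (0, 0))"
    unfolding det_2 matM_def vector_2 by (intro tendsto_intros m11 m12 m22)
  then show ?thesis by simp
qed

text \<open>Holomorphy and the majorant are required on radius \<open>3 * R\<close> to leave room
  for two Cauchy estimates. The equations and the bounds that make roots small are required only on
  radius \<open>R\<close>, where the branch lives.\<close>

locale local_solution =
  fixes p q :: "complex \<Rightarrow> complex \<Rightarrow> complex" and b :: "nat \<Rightarrow> complex \<Rightarrow> complex \<Rightarrow> complex"
    and e R :: real
  assumes e: "0 < e" and R: "0 < R"
    and holo: "p holomorphic2_on ball 0 (3 * R) \<times> ball 0 (3 * R)"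
      "q holomorphic2_on ball 0 (3 * R) \<times> ball 0 (3 * R)"
      "\<And>k. b k holomorphic2_on ball 0 (3 * R) \<times> ball 0 (3 * R)"
    and maj: "majorized e (ball 0 (3 * R) \<times> ball 0 (3 * R)) (\<lambda>k w. b k (fst w) (snd w))"
    and p_le: "\<And>t x. t \<in> ball 0 (3 * R) \<Longrightarrow> x \<in> ball 0 (3 * R) \<Longrightarrow> norm (p t x) \<le> 1"
    and p_less: "\<And>t x. t \<in> ball 0 R \<Longrightarrow> x \<in> ball 0 R \<Longrightarrow> norm (p t x) < e\<^sup>2 / 2"
    and q_less: "\<And>t x. t \<in> ball 0 R \<Longrightarrow> x \<in> ball 0 R \<Longrightarrow> norm (q t x) < e ^ 3 / 2"
    and qt: "\<And>t x. t \<in> ball 0 R \<Longrightarrow> x \<in> ball 0 R \<Longrightarrow> Dt q t x \<noteq> 0"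
    and fix_pq: "\<And>t x. t \<in> ball 0 R \<Longrightarrow> x \<in> ball 0 R \<Longrightarrow>
        matM p q b t x *v vector [Dt p t x, Dt q t x] = rhsB p q b t x"
    and fix_b: "\<And>t x k. t \<in> ball 0 R \<Longrightarrow> x \<in> ball 0 R \<Longrightarrow> Dt (b k) t x = rhsb p q b p q k t x"

section \<open>The function \<open>u\<close> on the domain of a branch\<close>

locale local_branch = local_solution +
  fixes D :: "(complex \<times> complex) set" and z :: "complex \<Rightarrow> complex \<Rightarrow> complex"
  assumes D: "D \<subseteq> ball 0 R \<times> ball 0 R" and branch: "cubic_branch p q z D"
begin

lemma z_root:
  assumes "(t, x) \<in> D"
  shows "z t x ^ 3 = p t x * z t x + q t x" "3 * (z t x)\<^sup>2 - p t x \<noteq> 0" "norm (z t x) < e"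
proof -
  show 1: "z t x ^ 3 = p t x * z t x + q t x"
    using branch assms unfolding cubic_branch_def by blast
  have "4 * p t x ^ 3 - 27 * q t x ^ 2 \<noteq> 0"
    using branch assms unfolding cubic_branch_def by blast
  with 1 show "3 * (z t x)\<^sup>2 - p t x \<noteq> 0" by (rule simple_cubic_root)
  show "norm (z t x) < e"
    using cubic_root_small[OF 1 _ _ e] p_less q_less D assms by blast
qed

lemma z_holo: "z holomorphic2_on D" and D_open: "open D"
  using branch unfolding cubic_branch_def by blast+

lemma ball_mono: "s \<in> ball 0 R \<Longrightarrow> s \<in> ball 0 (3 * R)" for s :: complex
  using R by auto

lemma t_slice:
  assumes "(t, x) \<in> D"
  shows "cubic_series {s. (s, x) \<in> D} e (max 1 (1 / R)) (\<lambda>s. p s x) (\<lambda>s. q s x) (\<lambda>s. z s x) (\<lambda>k s. b k s x)"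
proof -
  have x: "x \<in> ball 0 (3 * R)" using assms D ball_mono by blast
  show ?thesis
  proof (rule cubic_series_polydisc_slice[OF R e])
    have "open ((\<lambda>s. (s, x)) -` D)"
      using D_open by (intro open_vimage continuous_intros)
    then show "open {s. (s, x) \<in> D}" by (simp add: vimage_def)
    show "majorized e (ball 0 (3 * R)) (\<lambda>k s. b k s x)"
      using maj x unfolding majorized_def by (auto simp: Ball_def)
  qed (use x D z_root p_le in \<open>auto intro!: holomorphic2_slice(1)[OF holo(1)] holomorphic2_slice(1)[OF holo(2)]
      holomorphic2_slice(1)[OF holo(3)] holomorphic2_slice(1)[OF z_holo]\<close>)
qed

lemma x_slice:
  assumes "(t, x) \<in> D"
  shows "cubic_series {y. (t, y) \<in> D} e (max 1 (1 / R)) (p t) (q t) (z t) (\<lambda>k. b k t)"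
proof -
  have t: "t \<in> ball 0 (3 * R)" using assms D ball_mono by blast
  show ?thesis
  proof (rule cubic_series_polydisc_slice[OF R e])
    have "open ((\<lambda>y. (t, y)) -` D)"
      using D_open by (intro open_vimage continuous_intros)
    then show "open {y. (t, y) \<in> D}" by (simp add: vimage_def)
    show "majorized e (ball 0 (3 * R)) (\<lambda>k. b k t)"
      using maj t unfolding majorized_def by (auto simp: Ball_def)
  qed (use t D z_root p_le in \<open>auto intro!: holomorphic2_slice(2)[OF holo(1)] holomorphic2_slice(2)[OF holo(2)]
      holomorphic2_slice(2)[OF holo(3)] holomorphic2_slice(2)[OF z_holo]\<close>)
qed

text \<open>The coefficients have a common majorant and \<open>norm (z t x) < e\<close>. One
  numerical series thus gives both summability and joint holomorphy of \<open>u\<close>.\<close>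

lemma u_term_majorized: "\<exists>h. summable h \<and> (\<forall>k t x. (t, x) \<in> D \<longrightarrow> norm (u_term p b z t x k) \<le> h k)"
proof -
  have p1: "norm (- p (fst w) (snd w)) \<le> 1" if "w \<in> D" for w
    using that D p_le ball_mono by (cases w) auto
  have "majorized e D (\<lambda>k w. b k (fst w) (snd w))"
    using maj by (rule majorized_subset) (use D ball_mono in blast)
  from majorized_shift[OF this]
  have sh: "majorized e D (\<lambda>k w. shift b i k (fst w) (snd w))" for i
    unfolding shift_eq .
  have 3: "majorized e D (\<lambda>k w. 3 * shift b 3 k (fst w) (snd w))"
    by (rule majorized_mult[where C = 3, OF sh]) auto
  have 1: "majorized e D (\<lambda>k w. - p (fst w) (snd w) * shift b 1 k (fst w) (snd w))"
    by (rule majorized_mult[where C = 1, OF sh]) (use p1 in auto)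
  have "majorized e D (\<lambda>k w. 1 / of_nat k *
      (- p (fst w) (snd w) * shift b 1 k (fst w) (snd w) + 3 * shift b 3 k (fst w) (snd w)))"
    by (rule majorized_mult[where C = 1, OF majorized_add[OF 1 3]])
      (auto simp: norm_divide divide_simps)
  then obtain m where m: "summable (\<lambda>k. m k * e ^ k)"
    "\<And>k w. w \<in> D \<Longrightarrow> norm (1 / of_nat k *
      (- p (fst w) (snd w) * shift b 1 k (fst w) (snd w) + 3 * shift b 3 k (fst w) (snd w))) \<le> m k"
    unfolding majorized_def by blast
  have "norm (u_term p b z t x k) \<le> m k * e ^ k" if tx: "(t, x) \<in> D" for k t x
  proof -
    have "norm (u_term p b z t x k) = norm (1 / of_nat k *
      (- p t x * shift b 1 k t x + 3 * shift b 3 k t x)) * norm (z t x) ^ k"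
      unfolding u_term_def norm_mult norm_power ..
    also have "\<dots> \<le> m k * e ^ k"
      using m(2)[OF tx, of k] z_root(3)[OF tx] order_trans[OF norm_ge_zero m(2)[OF tx, of k]]
      by (intro mult_mono power_mono) auto
    finally show ?thesis .
  qed
  with m(1) show ?thesis by blast
qed

lemma u_term_summable: "(t, x) \<in> D \<Longrightarrow> summable (u_term p b z t x)"
  using u_term_majorized summable_comparison_test' by metis

lemma u_holomorphic: "u_fun p b z holomorphic2_on D"
proof -
  have sub: "D \<subseteq> ball 0 (3 * R) \<times> ball 0 (3 * R)" using D ball_mono by blast
  have pb: "p holomorphic2_on D" "b k holomorphic2_on D" for k
    using sub by (blast intro: holomorphic2_subset[OF holo(1)] holomorphic2_subset[OF holo(3)])+
  have sh: "shift b i k holomorphic2_on D" for i k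
    using pb(2) holomorphic2_const by (simp add: shift_def)
  have "(\<lambda>t x. 1 / of_nat k * (- 1 * p t x * shift b 1 k t x + 3 * shift b 3 k t x) * z t x ^ k) holomorphic2_on D" for k
    by (intro holomorphic2_mult holomorphic2_add holomorphic2_power holomorphic2_const pb sh z_holo)
  then have "(\<lambda>t x. u_term p b z t x k) holomorphic2_on D" for k
    by (simp add: u_term_def)
  with u_term_majorized show ?thesis
    unfolding u_fun_def[abs_def] by (auto intro: holomorphic2_suminf[OF D_open])
qed

lemma pde:
  assumes tx: "(t, x) \<in> D"
  shows "Dt (Dt (u_fun p b z)) t x - Dx (u_fun p b z) t x * Dx (Dx (u_fun p b z)) t x = 0"
proof -
  \<comment> \<open>The two slices pass through the same point \<open>(t, x)\<close>, so that both
    derivatives become series evaluated at the same root.\<close>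
  interpret T: cubic_series "{s. (s, x) \<in> D}" e "max 1 (1 / R)" "\<lambda>s. p s x" "\<lambda>s. q s x" "\<lambda>s. z s x" "\<lambda>k s. b k s x"
    using tx by (rule t_slice)
  interpret X: cubic_series "{y. (t, y) \<in> D}" e "max 1 (1 / R)" "p t" "q t" "z t" "\<lambda>k. b k t"
    using tx by (rule x_slice)
  have t: "t \<in> {s. (s, x) \<in> D}" and x: "x \<in> {y. (t, y) \<in> D}" using tx by simp_all
  have box: "t \<in> ball 0 R" "x \<in> ball 0 R" using tx D by auto
  define Z where "Z = z t x"
  have Z: "norm Z < e" "3 * Z\<^sup>2 - p t x \<noteq> 0" unfolding Z_def using z_root[OF tx] by simp_all
  have P: "norm (p t x / 3) < e\<^sup>2"
  proof -
    have "norm (p t x / 3) = norm (p t x) / 3" by (simp add: norm_divide)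
    then show ?thesis using p_less[OF box] zero_less_power[OF e, of 2] by linarith
  qed

  have uT: "(\<lambda>s. u_fun p b z s x) = T.v" by (simp add: fun_eq_iff u_fun_eq T.v_def)
  have uX: "u_fun p b z t = X.v" by (simp add: fun_eq_iff u_fun_eq X.v_def)
  have utt: "Dt (Dt (u_fun p b z)) t x = eval_fps (T.X t) Z + eval_fps (T.W t) Z / (3 * Z\<^sup>2 - p t x)"
    unfolding Dt_def uT T.deriv2_v[OF t] Z_def ..
  have ux: "Dx (u_fun p b z) t x = eval_fps (X.U x) Z"
    unfolding Dx_def uX X.deriv_v[OF x] Z_def ..
  have uxx: "Dx (Dx (u_fun p b z)) t x = eval_fps (X.X x) Z + eval_fps (X.W x) Z / (3 * Z\<^sup>2 - p t x)"
    unfolding Dx_def uX X.deriv2_v[OF x] Z_def ..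

  have U: "X.U x $ k = coefU p q b k t x" for k
    unfolding X.U_nth coefU_def shift_eq unfolding Dx_def ..
  have XX: "X.X x $ k = coefX p q b k t x" for k
    unfolding X.X_nth coefX_def shift_eq unfolding Dx_def ..
  have WX: "X.W x $ k = coefW p q b k t x" for k
    unfolding X.W_nth coefW_def shift_eq unfolding Dx_def ..
  define A where "A = T.W t - X.U x * X.W x"
  have cA: "conv e A" unfolding A_def by (intro conv_intros T.conv_W X.conv_U X.conv_W t x)
  have A_nth: "A $ k = calA p q b p q k t x" for k
    unfolding A_def calA_def fps_sub_nth fps_mult_nth U WX T.W_nth shift_eq atLeast0AtMost
    unfolding Dt_def by (simp add: power2_eq_square mult_ac)
  \<comment> \<open>A second reading of the same coefficients: \<open>calA\<close> leads to
    \<open>calC\<close>, while \<open>calB\<close> leads to the rows of the linear system.\<close>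
  have A_calB: "A $ k = 2 * of_nat k * b k t x * Dt p t x * Dt q t x + (of_nat k + 1) * (Dt q t x)\<^sup>2 * b (k + 1) t x
      - calB p q b k t x" for k
    unfolding A_nth calA_def calB_def by (simp add: power2_eq_square algebra_simps)

  have cB: "conv e (fps_X * fps_deriv (T.B t))" "conv e (fps_deriv (T.B t))"
    by (intro conv_intros T.conv_B t)+
  have XB: "(fps_X * fps_deriv (T.B t)) $ k = of_nat k * b k t x" for k
    by (cases k) (simp_all add: fps_X_mult_nth)
  note sp = conv_sparse_summable[OF _ P e]
  \<comment> \<open>Summability of the three entry series is needed to split the infinite sums in
    \<open>rows\<close>.\<close>
  define s11 where "s11 = (\<lambda>k. (p t x / 3) ^ k * of_nat k * Dt q t x * b (2 * k) t x)"
  define s12 where "s12 = (\<lambda>k. (p t x / 3) ^ k * of_nat (2 * k + 1) * Dt q t x * b (2 * k + 1) t x)"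
  define s22 where "s22 = (\<lambda>k. (p t x / 3) ^ k * of_nat (k + 1) * Dt q t x * b (2 * k + 2) t x)"
  have "s11 = (\<lambda>k. Dt q t x / 2 * ((fps_X * fps_deriv (T.B t)) $ (0 + 2 * k) * (p t x / 3) ^ k))"
    unfolding XB s11_def by (simp add: fun_eq_iff mult_ac)
  then have s11: "summable s11" using sp[OF cB(1), of 0] summable_mult by metis
  have "s12 = (\<lambda>k. Dt q t x * (fps_deriv (T.B t) $ (0 + 2 * k) * (p t x / 3) ^ k))"
    unfolding s12_def by (simp add: fun_eq_iff mult_ac)
  then have s12: "summable s12" using sp[OF cB(2), of 0] summable_mult by metis
  have "s22 = (\<lambda>k. Dt q t x / 2 * (fps_deriv (T.B t) $ (1 + 2 * k) * (p t x / 3) ^ k))"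
    unfolding s22_def by (simp add: fun_eq_iff algebra_simps)
  then have s22: "summable s22" using sp[OF cB(2), of 1] summable_mult by metis
  note rows = matM_mult_vec[OF fix_pq[OF box], folded s11_def s12_def s22_def]

  have ev: "(\<Sum>j. A $ (2 * j) * (p t x / 3) ^ j) = 0"
  proof -
    have sA: "summable (\<lambda>j. A $ (2 * j) * (p t x / 3) ^ j)" using sp[OF cA, of 0] by simp
    \<comment> \<open>Termwise, the right-hand side is the row of the matrix product minus the terms
      of \<open>A\<close>; equality of the sums forces the sum over \<open>A\<close> to
      vanish.\<close>
    have "(\<lambda>k. (p t x / 3) ^ k * calB p q b (2 * k) t x)
        = (\<lambda>k. 4 * s11 k * Dt p t x + s12 k * Dt q t x - A $ (2 * k) * (p t x / 3) ^ k)"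
      unfolding A_calB s11_def s12_def by (simp add: fun_eq_iff power2_eq_square algebra_simps)
    moreover have "(\<lambda>k. 4 * s11 k * Dt p t x + s12 k * Dt q t x - A $ (2 * k) * (p t x / 3) ^ k) sums
        (4 * suminf s11 * Dt p t x + suminf s12 * Dt q t x - (\<Sum>j. A $ (2 * j) * (p t x / 3) ^ j))"
      by (intro sums_diff sums_add sums_mult sums_mult2 summable_sums s11 s12 sA)
    ultimately show ?thesis using rows(1) by (simp add: sums_iff)
  qed
  have od: "(\<Sum>j. A $ (1 + 2 * j) * (p t x / 3) ^ j) = 0"
  proof -
    have sA: "summable (\<lambda>j. A $ (1 + 2 * j) * (p t x / 3) ^ j)" using sp[OF cA, of 1] by simp
    have "(\<lambda>k. (p t x / 3) ^ k * calB p q b (2 * k + 1) t x)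
        = (\<lambda>k. 2 * s12 k * Dt p t x + 2 * s22 k * Dt q t x - A $ (1 + 2 * k) * (p t x / 3) ^ k)"
      unfolding A_calB s12_def s22_def by (simp add: fun_eq_iff power2_eq_square algebra_simps)
    moreover have "(\<lambda>k. 2 * s12 k * Dt p t x + 2 * s22 k * Dt q t x - A $ (1 + 2 * k) * (p t x / 3) ^ k) sums
        (2 * suminf s12 * Dt p t x + 2 * suminf s22 * Dt q t x - (\<Sum>j. A $ (1 + 2 * j) * (p t x / 3) ^ j))"
      by (intro sums_diff sums_add sums_mult sums_mult2 summable_sums s12 s22 sA)
    ultimately show ?thesis using rows(2) by (simp add: sums_iff)
  qed

  \<comment> \<open>Defining \<open>C\<close> from \<open>U\<close> and the two series
    \<open>X\<close> gives its convergence at once. The equations for the \<open>b k\<close> then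
    identify its coefficients with \<open>calC\<close>.\<close>
  define C where "C = fps_const 3 * (X.U x * X.X x - T.X t)"
  have cUX: "conv e (X.U x * X.X x)" "conv e (X.U x * X.X x - T.X t)"
    by (intro conv_intros X.conv_U X.conv_X T.conv_X t x)+
  then have cC: "conv e C" unfolding C_def by (intro conv_mult conv_const)
  have C_nth: "C $ k = (\<Sum>j. A $ (k + 2 + 2 * j) * (p t x / 3) ^ j)" for k
  proof -
    have "2 * Dt q t x * Dt (b k) t x =
      - (2 - 2 / of_nat k) * Dt (shift b 1 k) t x * Dt p t x
       - (1 - 1 / of_nat k) * shift b 1 k t x * Dt (Dt p) t x
       - b k t x * Dt (Dt q) t x
       - 1 / of_nat k * (- p t x * Dt (Dt (shift b 1 k)) t x + 3 * Dt (Dt (shift b 3 k)) t x)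
       - 1 / 3 * calC p q b p q k t x
       + (\<Sum>j\<le>k. coefU p q b j t x * coefX p q b (k - j) t x)"
      unfolding fix_b[OF box, of k] rhsb_def using qt[OF box] by (simp only: mult.assoc[symmetric]) simp
    moreover have "T.X t $ k = (2 - 2 / of_nat k) * Dt (shift b 1 k) t x * Dt p t x
       + (1 - 1 / of_nat k) * shift b 1 k t x * Dt (Dt p) t x
       + b k t x * Dt (Dt q) t x + 2 * Dt (b k) t x * Dt q t x
       + 1 / of_nat k * (- p t x * Dt (Dt (shift b 1 k)) t x + 3 * Dt (Dt (shift b 3 k)) t x)"
      unfolding T.X_nth shift_eq unfolding Dt_def ..
    moreover have "(X.U x * X.X x) $ k = (\<Sum>j\<le>k. coefU p q b j t x * coefX p q b (k - j) t x)"
      unfolding fps_mult_nth U XX atLeast0AtMost ..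
    \<comment> \<open>Eliminates \<open>Dt (b k) t x\<close> between the preceding formulas, with
      variables in place of the long terms.\<close>
    moreover have "3 * (m - y) = c"
      if "2 * q1 * d = - a1 * a2 * a3 - a4 - a5 - a6 * a7 - 1 / 3 * c + m"
        "y = a1 * a2 * a3 + a4 + a5 + 2 * d * q1 + a6 * a7"
      for a1 a2 a3 a4 a5 a6 a7 c d m q1 y :: complex
    proof -
      have "y = a1 * a2 * a3 + a4 + a5 + a6 * a7 + 2 * q1 * d"
        using that(2) by (simp add: mult_ac)
      then show ?thesis unfolding that(1) by simp
    qed
    ultimately have "C $ k = calC p q b p q k t x"
      unfolding C_def fps_mult_left_const_nth fps_sub_nth by presburger
    then show ?thesis unfolding calC_def A_nth .
  qed
  have "eval_fps A Z = (Z\<^sup>2 - p t x / 3) * eval_fps C Z"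
    by (rule eval_factor[OF cA cC P Z(1) ev od C_nth])
  moreover have "eval_fps A Z = eval_fps (T.W t) Z - eval_fps (X.U x) Z * eval_fps (X.W x) Z"
    unfolding A_def using Z(1)
    by (simp add: eval_diff[of e] eval_mult[of e] conv_mult T.conv_W[OF t] X.conv_U[OF x] X.conv_W[OF x])
  moreover have "eval_fps C Z = 3 * (eval_fps (X.U x) Z * eval_fps (X.X x) Z - eval_fps (T.X t) Z)"
    unfolding C_def using Z(1) cUX
    by (simp add: eval_const_mult[of e] eval_diff[of e] eval_mult[of e] T.conv_X[OF t] X.conv_U[OF x] X.conv_X[OF x])
  \<comment> \<open>The factor 3 in \<open>C\<close> turns \<open>Z\<^sup>2 - p t x / 3\<close> into
    the denominator of the second derivatives.\<close>
  ultimately have "eval_fps (T.W t) Z - eval_fps (X.U x) Z * eval_fps (X.W x) Z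
     = (3 * Z\<^sup>2 - p t x) * (eval_fps (X.U x) Z * eval_fps (X.X x) Z - eval_fps (T.X t) Z)"
    by (simp add: algebra_simps)
  then have "eval_fps (T.W t) Z = eval_fps (X.U x) Z * eval_fps (X.W x) Z
     + (3 * Z\<^sup>2 - p t x) * (eval_fps (X.U x) Z * eval_fps (X.X x) Z - eval_fps (T.X t) Z)"
    by (simp add: algebra_simps)
  moreover have "y + v / d - g * (X + w / d) = 0"
    if "v = g * w + d * (g * X - y)" "d \<noteq> 0" for v g w d X y :: complex
    using that by (simp add: field_simps)
  ultimately show ?thesis
    unfolding utt ux uxx using Z(2) by blast
qed

end

section \<open>From germs at the origin to a polydisc\<close>

theorem lemma7p1:
  fixes p q :: "complex \<Rightarrow> complex \<Rightarrow> complex"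
    and b :: "nat \<Rightarrow> complex \<Rightarrow> complex \<Rightarrow> complex"
  assumes data: "solution_data p q b"
    and p0: "\<forall>\<^sub>F x in nhds 0. p 0 x = 0"
    and q0: "\<forall>\<^sub>F x in nhds 0. q 0 x = x"
    and qt0: "Dt q 0 0 = 1"
    and b0: "\<forall>\<^sub>F x in nhds 0. b 0 0 x = 1 \<and> b 1 0 x = 1 \<and> (\<forall>k\<ge>2. b k 0 x = 0)"
    and fixpoint: "F_maps p q b p q b"
  shows "\<exists>N. open N \<and> (0, 0) \<in> N \<and>
    (\<forall>D z r. D \<subseteq> N \<longrightarrow> cubic_branch p q z D \<longrightarrow>
       cbrt_branch r {x. (0, x) \<in> D} \<longrightarrow> (\<forall>x. (0, x) \<in> D \<longrightarrow> z 0 x = r x) \<longrightarrow>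
       (\<forall>(t, x)\<in>D. summable (u_term p b z t x)) \<and>
       u_fun p b z holomorphic2_on D \<and>
       (\<forall>(t, x)\<in>D. Dt (Dt (u_fun p b z)) t x
                    - Dx (u_fun p b z) t x * Dx (Dx (u_fun p b z)) t x = 0) \<and>
       (\<forall>x. (0, x) \<in> D \<longrightarrow> u_fun p b z 0 x = x + 3 / 4 * r x ^ 4))"
proof -
  obtain N0 e where N0: "open N0" "(0, 0) \<in> N0" and holo: "p holomorphic2_on N0" "q holomorphic2_on N0"
      "\<And>k. b k holomorphic2_on N0"
    and bdd: "\<And>k. bounded ((\<lambda>w. b k (fst w) (snd w)) ` N0)" and e: "0 < e"
    and sm: "summable (\<lambda>k. (SUP w\<in>N0. norm (b k (fst w) (snd w))) * e ^ k)"
    using data unfolding solution_data_def by blast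
  have maj: "majorized e N0 (\<lambda>k w. b k (fst w) (snd w))"
  proof (rule majorizedI[OF sm])
    fix k w assume w: "w \<in> N0"
    \<comment> \<open>The supremum is known to be an upper bound only once the values are
      bounded.\<close>
    have "bdd_above ((\<lambda>w. norm (b k (fst w) (snd w))) ` N0)"
      using bdd[of k] by (auto simp: bounded_iff bdd_above_def)
    then show "norm (b k (fst w) (snd w)) \<le> (SUP w\<in>N0. norm (b k (fst w) (snd w)))"
      using w by (rule cSUP_upper2) simp
  qed
  obtain N1 where N1: "open N1" "(0, 0) \<in> N1"
    and F: "\<forall>(t, x)\<in>N1. vector [Dt p t x, Dt q t x] = matrix_inv (matM p q b t x) *v rhsB p q b t x"
      "\<forall>(t, x)\<in>N1. \<forall>k. Dt (b k) t x = rhsb p q b p q k t x"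
    and F3: "\<And>x. (0, x) \<in> N1 \<Longrightarrow>
           p 0 x = 0 \<and> q 0 x = x \<and> b 0 0 x = 1 \<and> b 1 0 x = 1 \<and> (\<forall>k\<ge>2. b k 0 x = 0)"
    using fixpoint unfolding F_maps_def by (elim exE conjE) blast
  have F1: "vector [Dt p t x, Dt q t x] = matrix_inv (matM p q b t x) *v rhsB p q b t x"
    and F2: "Dt (b k) t x = rhsb p q b p q k t x" if "(t, x) \<in> N1" for t x k
    using F that by blast+
  note init = F3[OF N1(2)]
  note cont = holomorphic2_tendsto[OF _ N0]
  have "\<forall>\<^sub>F w in nhds (0, 0). norm (p (fst w) (snd w)) < min 1 (e\<^sup>2 / 2)"
    using cont[OF holo(1)] init e by (intro order_tendstoD(2)[OF tendsto_norm]) auto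
  moreover have "\<forall>\<^sub>F w in nhds (0, 0). norm (q (fst w) (snd w)) < e ^ 3 / 2"
    using cont[OF holo(2)] init e by (intro order_tendstoD(2)[OF tendsto_norm]) auto
  moreover have "\<forall>\<^sub>F w in nhds (0, 0). Dt q (fst w) (snd w) \<noteq> 0"
    using tendsto_Dt[OF N0 holo(2)] qt0 by (intro tendsto_imp_eventually_ne) auto
  moreover have "((\<lambda>w. det (matM p q b (fst w) (snd w))) \<longlongrightarrow> - 2) (nhds (0, 0))"
    using init qt0 by (intro det_matM_tendsto[OF holo N0 e maj]) auto
  then have "\<forall>\<^sub>F w in nhds (0, 0). det (matM p q b (fst w) (snd w)) \<noteq> 0"
    by (rule tendsto_imp_eventually_ne) simp
  moreover have "\<forall>\<^sub>F w in nhds (0, 0). w \<in> N0 \<inter> N1"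
    using N0 N1 by (intro eventually_nhds_in_open) auto
  ultimately have "\<forall>\<^sub>F w in nhds (0, 0). norm (p (fst w) (snd w)) < min 1 (e\<^sup>2 / 2) \<and>
      norm (q (fst w) (snd w)) < e ^ 3 / 2 \<and> Dt q (fst w) (snd w) \<noteq> 0 \<and>
      det (matM p q b (fst w) (snd w)) \<noteq> 0 \<and> w \<in> N0 \<inter> N1"
    by eventually_elim blast
  then obtain Pt Px where Pt: "eventually Pt (nhds 0)" and Px: "eventually Px (nhds 0)"
    and near: "\<And>t x. Pt t \<Longrightarrow> Px x \<Longrightarrow> norm (p t x) < min 1 (e\<^sup>2 / 2) \<and>
      norm (q t x) < e ^ 3 / 2 \<and> Dt q t x \<noteq> 0 \<and> det (matM p q b t x) \<noteq> 0 \<and> (t, x) \<in> N0 \<inter> N1"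
    unfolding nhds_prod eventually_prod_filter by auto
  \<comment> \<open>Joining the two conditions gives one radius for both variables.\<close>
  have "\<forall>\<^sub>F s in nhds 0. Pt s \<and> Px s" using Pt Px by (rule eventually_conj)
  then obtain d where d: "0 < d" "\<And>s. dist s 0 < d \<Longrightarrow> Pt s \<and> Px s"
    unfolding eventually_nhds_metric by blast
  define R where "R = d / 3"
  have R: "0 < R" "3 * R = d" using d(1) by (simp_all add: R_def)
  have near3: "norm (p t x) < min 1 (e\<^sup>2 / 2) \<and>
      norm (q t x) < e ^ 3 / 2 \<and> Dt q t x \<noteq> 0 \<and> det (matM p q b t x) \<noteq> 0 \<and> (t, x) \<in> N0 \<inter> N1"
    if "t \<in> ball 0 (3 * R)" "x \<in> ball 0 (3 * R)" for t x
    using that d(2)[of t] d(2)[of x] unfolding R(2) by (intro near) (auto simp: dist_commute)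
  have sub: "ball 0 (3 * R) \<times> ball 0 (3 * R) \<subseteq> N0" using near3 by blast
  have near1: "norm (p t x) < e\<^sup>2 / 2" "norm (q t x) < e ^ 3 / 2" "Dt q t x \<noteq> 0"
      "det (matM p q b t x) \<noteq> 0" "(t, x) \<in> N1"
    if "t \<in> ball 0 R" "x \<in> ball 0 R" for t x
    using near3[of t x] that R(1) by auto
  interpret local_solution p q b e R
  proof
    show "majorized e (ball 0 (3 * R) \<times> ball 0 (3 * R)) (\<lambda>k w. b k (fst w) (snd w))"
      using maj sub by (rule majorized_subset)
    show "norm (p t x) \<le> 1" if "t \<in> ball 0 (3 * R)" "x \<in> ball 0 (3 * R)" for t x
      using near3[OF that] by simp
    show "matM p q b t x *v vector [Dt p t x, Dt q t x] = rhsB p q b t x"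
      if "t \<in> ball 0 R" "x \<in> ball 0 R" for t x
      using matrix_inv_solve[OF near1(4)[OF that] F1[OF near1(5)[OF that]]] .
  qed (use e R holo[THEN holomorphic2_subset, OF sub] near1 F2 in auto)
  show ?thesis
  proof (intro exI[of _ "ball 0 R \<times> ball 0 R"] conjI allI impI)
    show "open (ball (0 :: complex) R \<times> ball (0 :: complex) R)" by (intro open_Times open_ball)
    show "(0, 0) \<in> ball (0 :: complex) R \<times> ball (0 :: complex) R" using R by simp
    fix D z r assume D: "D \<subseteq> ball 0 R \<times> ball 0 R" "cubic_branch p q z D"
      and r: "\<forall>x. (0, x) \<in> D \<longrightarrow> z 0 x = r x"
    interpret local_branch p q b e R D z by unfold_locales (fact D)+
    show "\<forall>(t, x)\<in>D. summable (u_term p b z t x)" using u_term_summable by blast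
    show "u_fun p b z holomorphic2_on D" by (rule u_holomorphic)
    show "\<forall>(t, x)\<in>D. Dt (Dt (u_fun p b z)) t x
          - Dx (u_fun p b z) t x * Dx (Dx (u_fun p b z)) t x = 0" using pde by blast
    fix x assume x: "(0, x) \<in> D"
    have "x \<in> ball 0 R" using x D by auto
    then have i: "p 0 x = 0" "q 0 x = x" "b 0 0 x = 1" "b (Suc 0) 0 x = 1" "\<And>k. 2 \<le> k \<Longrightarrow> b k 0 x = 0"
      using F3[OF near1(5)] R by auto
    have "u_term p b z 0 x k = 0" if "k \<notin> {3, 4}" for k
    proof -
      \<comment> \<open>With \<open>p 0 x = 0\<close> only the \<open>b\<close>-coefficient of index
        \<open>k - 3\<close> remains, and at \<open>t = 0\<close> it is nonzero only for index 0 or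
        1.\<close>
      have "k < 3 \<or> 2 \<le> k - 3" using that by auto
      then show ?thesis using i by (auto simp: u_term_def shift_eq)
    qed
    then have "u_fun p b z 0 x = sum (u_term p b z 0 x) {3, 4}"
      unfolding u_fun_def by (intro suminf_finite) auto
    also have "\<dots> = z 0 x ^ 3 + 3 / 4 * z 0 x ^ 4"
      using i by (simp add: u_term_def shift_eq)
    finally show "u_fun p b z 0 x = x + 3 / 4 * r x ^ 4"
      \<comment> \<open>At \<open>t = 0\<close> the cubic reads \<open>z 0 x ^ 3 = x\<close>, and
        the branch hypothesis replaces \<open>z 0 x\<close> by \<open>r x\<close>.\<close>
      using z_root(1)[OF x] i r x by simp
  qed
qed

end
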